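(* Let $X$ be a locally compact separable metric space endowed with its Borel $\sigma$-algebra $\mathscr{B}(X)$, let $V$ be a finite-dimensional real vector space and let $|\cdot|_V$ be a seminorm on $V$. Let $(\mu_n)_{n\in\mathbb{N}}$ be a sequence of Borel vector measures $\mu_n:\mathscr{B}(X)\to V$ that converges widely to a Borel vector measure $\mu:\mathscr{B}(X)\to V$. If the sequence of ranges $(\mathcal{R}(\mu_n))_{n\in\mathbb{N}}$ converges to $\mathcal{R}(\mu)$ in Hausdorff distance, then $$\lim_{n\to\infty}|\mu_n|_V(X)=|\mu|_V(X).$$
   Context: A vector measure is a countably additive map $\mu:\Sigma\to V$ from a $\sigma$-algebra $\Sigma$ on $X$ to a finite-dimensional real vector space $V$. The total variation of $\mu$ with respect to a seminorm $|\cdot|_V$ is, for $A\in\Sigma$, $|\mu|_V(A)=\sup\{\sum_{i=1}^m|\mu(E_i)|_V : E_1,\dots,E_m\in\Sigma \text{ pairwise disjoint subsets of } A\}$. The range of $\mu$ on $A\in\Sigma$ is $\mathcal{R}_A(\mu)=\overline{\mathrm{conv}}\{\mu(E): E\in\Sigma, E\subseteq A\}$ (closed convex hull), and $\mathcal{R}(\mu)=\mathcal{R}_X(\mu)$; it is a compact convex subset of $V$. A sequence $(\mu_n)$ of Borel vector measures on $X$ converges widely to $\mu$ if $\lim_{n}\int_X\varphi\,d\mu_n=\int_X\varphi\,d\mu$ in $V$ for every $\varphi\in C_c(X,\mathbb{R})$. Hausdorff distance between nonempty compact subsets of $V$ is taken with respect to any norm on $V$ (all are equivalent for this convergence). *)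

theory Defs
  imports "HOL-Analysis.Analysis"
begin

definition seminorm :: "('v::real_vector \<Rightarrow> real) \<Rightarrow> bool" where
  "seminorm N \<longleftrightarrow> (\<forall>x y. N (x + y) \<le> N x + N y) \<and> (\<forall>c x. N (c *\<^sub>R x) = \<bar>c\<bar> * N x)"

text \<open>Borel vector measure: countably additive map on the Borel sets of X with values in V
  (values on non-Borel sets are irrelevant).\<close>
definition vector_measure :: "('a::topological_space set \<Rightarrow> 'v::real_normed_vector) \<Rightarrow> bool" where
  "vector_measure \<mu> \<longleftrightarrow>
     (\<forall>A::nat \<Rightarrow> 'a set. range A \<subseteq> sets borel \<longrightarrow> disjoint_family A \<longrightarrow>
        (\<lambda>n. \<mu> (A n)) sums \<mu> (\<Union>n. A n))"

definition total_variation ::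
  "('v::real_vector \<Rightarrow> real) \<Rightarrow> ('a::topological_space set \<Rightarrow> 'v) \<Rightarrow> 'a set \<Rightarrow> ereal" where
  "total_variation N \<mu> A =
     (SUP p \<in> {(m::nat, E::nat \<Rightarrow> 'a set). disjoint_family_on E {..<m} \<and> (\<forall>i<m. E i \<in> sets borel \<and> E i \<subseteq> A)}.
        ereal (\<Sum>i<fst p. N (\<mu> (snd p i))))"

definition vm_range_on :: "('a::topological_space set \<Rightarrow> 'v::real_normed_vector) \<Rightarrow> 'a set \<Rightarrow> 'v set" where
  "vm_range_on \<mu> A = closure (convex hull {\<mu> E | E. E \<in> sets borel \<and> E \<subseteq> A})"

definition vm_range :: "('a::topological_space set \<Rightarrow> 'v::real_normed_vector) \<Rightarrow> 'v set" where
  "vm_range \<mu> = vm_range_on \<mu> UNIV"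

text \<open>Hausdorff distance between (nonempty compact) subsets of a metric space.\<close>
definition hausdorff_dist :: "'v::metric_space set \<Rightarrow> 'v set \<Rightarrow> real" where
  "hausdorff_dist S T = max (SUP x\<in>S. infdist x T) (SUP y\<in>T. infdist y S)"

definition jordan_pos :: "('a::topological_space set \<Rightarrow> real) \<Rightarrow> 'a set \<Rightarrow> real" where
  "jordan_pos c A = Sup {c E | E. E \<in> sets borel \<and> E \<subseteq> A}"

definition jordan_pos_measure :: "('a::topological_space set \<Rightarrow> real) \<Rightarrow> 'a measure" where
  "jordan_pos_measure c = measure_of UNIV (sets borel) (\<lambda>A. ennreal (jordan_pos c A))"

definition signed_integral :: "('a::topological_space set \<Rightarrow> real) \<Rightarrow> ('a \<Rightarrow> real) \<Rightarrow> real" where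
  "signed_integral c \<phi> =
     integral\<^sup>L (jordan_pos_measure c) \<phi> - integral\<^sup>L (jordan_pos_measure (\<lambda>A. - c A)) \<phi>"

definition vm_integral ::
  "('a::topological_space set \<Rightarrow> 'v::euclidean_space) \<Rightarrow> ('a \<Rightarrow> real) \<Rightarrow> 'v" where
  "vm_integral \<mu> \<phi> = (\<Sum>b\<in>Basis. signed_integral (\<lambda>A. \<mu> A \<bullet> b) \<phi> *\<^sub>R b)"

definition Cc :: "('a::topological_space \<Rightarrow> real) set" where
  "Cc = {\<phi>. continuous_on UNIV \<phi> \<and> compact (closure {x. \<phi> x \<noteq> 0})}"

definition widely_converges ::
  "(nat \<Rightarrow> 'a::topological_space set \<Rightarrow> 'v::euclidean_space) \<Rightarrow> ('a set \<Rightarrow> 'v) \<Rightarrow> bool" where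
  "widely_converges \<mu>s \<mu> \<longleftrightarrow> (\<forall>\<phi>\<in>Cc. (\<lambda>n. vm_integral (\<mu>s n) \<phi>) \<longlonglongrightarrow> vm_integral \<mu> \<phi>)"

end

(* Testing against C_c functions makes the total variation on an open set lower semicontinuous for
   every seminorm. For the seminorm w |-> |w . x|, the total variation is the sum of the suprema of
   w . x and of w . (-x) over the range, hence it converges on the whole space by convergence of the
   ranges; no mass is lost, so the variation in direction x is upper semicontinuous on closed sets.
   For the general seminorm N, partition the space into sets E_i whose values mu(E_i) nearly exhaust
   the Euclidean total variation. On E_i the measure mu varies little in the directions orthogonal to
   v_i = mu(E_i) / |mu(E_i)|. On closed sets F_i that cover the space and approximate the E_i, the same
   holds for mu_n in the limit, so |mu_n|_N(F_i) is at most N(v_i) |v_i . mu_n|(F_i) up to a small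
   error, which is asymptotically about N(mu(E_i)). *)
theory Submission
  imports Defs
begin

text \<open>Ranges see \<mu> only through their support functions, one direction at a time. A
  partition nearly optimal for \<open>N\<close> would say nothing about directions: \<open>N\<close>
  may be additive on vectors far from parallel, as the l1 norm is on a quadrant. The Euclidean norm
  is strictly convex, so a small loss in its triangle inequality forces almost parallel summands;
  hence the partition is chosen for \<open>norm\<close>, whatever \<open>N\<close> is. The pieces
  are mere Borel sets, while semicontinuity holds on open or closed sets. Compact subsets of the
  pieces are therefore enlarged to cells, according to which of them is nearest: strict inequalities
  give disjoint open cells, suited to lower bounds by superadditivity, weak ones give closed cells
  that cover, suited to upper bounds by subadditivity. Loss and misalignment are linked by a square
  root, linearised by a parameter \<open>t\<close>. It must be fixed before the partition, since the
  loss gets divided by it, and the number of pieces must be known before fixing the mass left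
  outside the compact sets.\<close>

section \<open>Finite additivity and boundedness of vector measures\<close>

lemma vector_measure_sums:
  assumes "vector_measure \<mu>" "\<And>n. A n \<in> sets borel" "disjoint_family A"
  shows "(\<lambda>n. \<mu> (A n)) sums \<mu> (\<Union>n. A n)"
  using assms unfolding vector_measure_def by (metis image_subsetI)

lemma vector_measure_empty:
  assumes "vector_measure \<mu>"
  shows "\<mu> {} = 0"
proof -
  have "(\<lambda>n::nat. \<mu> {}) sums \<mu> (\<Union>n::nat. {})"
    by (rule vector_measure_sums[OF assms]) (auto simp: disjoint_family_on_def)
  then have "(\<lambda>n::nat. \<mu> {}) \<longlonglongrightarrow> 0"
    by (intro summable_LIMSEQ_zero) (auto simp: sums_iff)
  then show ?thesis
    by (simp add: LIMSEQ_const_iff)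
qed

lemma vector_measure_Un:
  assumes "vector_measure \<mu>" "A \<in> sets borel" "B \<in> sets borel" "A \<inter> B = {}"
  shows "\<mu> (A \<union> B) = \<mu> A + \<mu> B"
proof -
  have "(\<lambda>n. \<mu> (binaryset A B n)) sums \<mu> (\<Union>n. binaryset A B n)"
    by (rule vector_measure_sums[OF assms(1)])
      (use assms in \<open>auto simp: binaryset_def disjoint_family_on_def\<close>)
  moreover have "(\<lambda>n. \<mu> (binaryset A B n)) sums (\<mu> A + \<mu> B)"
    using vector_measure_empty[OF assms(1)] by (intro binaryset_sums)
  ultimately show ?thesis
    by (simp add: UN_binaryset_eq sums_unique2)
qed

lemma vector_measure_Diff:
  assumes "vector_measure \<mu>" "A \<in> sets borel" "B \<in> sets borel" "B \<subseteq> A"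
  shows "\<mu> (A - B) = \<mu> A - \<mu> B"
proof -
  have "\<mu> ((A - B) \<union> B) = \<mu> (A - B) + \<mu> B"
    by (rule vector_measure_Un) (use assms in auto)
  moreover have "(A - B) \<union> B = A"
    using assms by auto
  ultimately show ?thesis
    by simp
qed

lemma vector_measure_split:
  assumes "vector_measure \<mu>" "A \<in> sets borel" "B \<in> sets borel"
  shows "\<mu> A = \<mu> (A \<inter> B) + \<mu> (A - B)"
proof -
  have "\<mu> ((A \<inter> B) \<union> (A - B)) = \<mu> (A \<inter> B) + \<mu> (A - B)"
    by (rule vector_measure_Un) (use assms in auto)
  then show ?thesis
    by (simp add: Int_Diff_Un)
qed

lemma vector_measure_UN:
  assumes "vector_measure \<mu>" "finite I" "\<And>i. i \<in> I \<Longrightarrow> A i \<in> sets borel" "disjoint_family_on A I"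
  shows "\<mu> (\<Union>i\<in>I. A i) = (\<Sum>i\<in>I. \<mu> (A i))"
  using assms(2-4)
proof (induction I)
  case empty
  then show ?case by (simp add: vector_measure_empty[OF assms(1)])
next
  case (insert j I)
  have "\<mu> (A j \<union> (\<Union>i\<in>I. A i)) = \<mu> (A j) + \<mu> (\<Union>i\<in>I. A i)"
    by (rule vector_measure_Un[OF assms(1)])
      (use insert in \<open>auto simp: disjoint_family_on_def\<close>)
  then show ?case
    using insert by (simp add: disjoint_family_on_def)
qed

lemma vector_measure_bounded_linear:
  assumes "vector_measure \<mu>" "bounded_linear f"
  shows "vector_measure (\<lambda>A. f (\<mu> A))"
  using assms bounded_linear.sums unfolding vector_measure_def by blast

lemma vector_measure_inner:
  fixes \<mu> :: "'a::topological_space set \<Rightarrow> 'v::real_inner"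
  assumes "vector_measure \<mu>"
  shows "vector_measure (\<lambda>A. \<mu> A \<bullet> x)"
  using vector_measure_bounded_linear[OF assms bounded_linear_inner_left] .

lemma vector_measure_uminus:
  assumes "vector_measure \<mu>"
  shows "vector_measure (\<lambda>A. - \<mu> A)"
  using vector_measure_bounded_linear[OF assms bounded_linear_minus[OF bounded_linear_ident]] .

text \<open>If the values on subsets of \<open>A\<close> are unbounded, some \<open>E \<subseteq> A\<close> has
  \<open>norm (\<mu> E) > norm (\<mu> A) + 1\<close>, so both \<open>E\<close> and \<open>A - E\<close> have norm at least 1, and one of them
  again has unbounded values on its subsets. Iterating contradicts summability.\<close>
lemma vector_measure_bounded:
  fixes \<mu> :: "'a::topological_space set \<Rightarrow> 'v::real_normed_vector"
  assumes "vector_measure \<mu>"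
  obtains B where "\<And>E. E \<in> sets borel \<Longrightarrow> norm (\<mu> E) \<le> B"
proof -
  define unb where "unb A \<longleftrightarrow> A \<in> sets borel \<and> (\<forall>B. \<exists>E\<in>sets borel. E \<subseteq> A \<and> norm (\<mu> E) > B)" for A
  have step: "\<exists>A'. unb A' \<and> A' \<subseteq> A \<and> norm (\<mu> (A - A')) \<ge> 1" if "unb A" for A
  proof -
    have A: "A \<in> sets borel"
      using that by (simp add: unb_def)
    obtain E where E: "E \<in> sets borel" "E \<subseteq> A" "norm (\<mu> E) > norm (\<mu> A) + 1"
      using \<open>unb A\<close> unfolding unb_def by meson
    have D: "\<mu> (A - E) = \<mu> A - \<mu> E"
      by (rule vector_measure_Diff) (use assms A E in auto)
    have nD: "norm (\<mu> (A - E)) \<ge> 1"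
      using E(3) norm_triangle_ineq2[of "\<mu> E" "\<mu> A"] unfolding D by (simp add: norm_minus_commute)
    have nE: "norm (\<mu> (A - (A - E))) \<ge> 1"
      using E by (simp add: Diff_Diff_Int Int_absorb1) (use norm_ge_zero[of "\<mu> A"] in linarith)
    have "unb E \<or> unb (A - E)"
    proof (rule ccontr)
      assume "\<not> (unb E \<or> unb (A - E))"
      then obtain B1 B2 where B:
        "\<And>F. F \<in> sets borel \<Longrightarrow> F \<subseteq> E \<Longrightarrow> norm (\<mu> F) \<le> B1"
        "\<And>F. F \<in> sets borel \<Longrightarrow> F \<subseteq> A - E \<Longrightarrow> norm (\<mu> F) \<le> B2"
        using A E(1) sets.Diff[OF A E(1)] unfolding unb_def by (meson not_less)
      obtain F where F: "F \<in> sets borel" "F \<subseteq> A" "norm (\<mu> F) > B1 + B2"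
        using \<open>unb A\<close> unfolding unb_def by meson
      have "norm (\<mu> F) \<le> norm (\<mu> (F \<inter> E)) + norm (\<mu> (F - E))"
        using vector_measure_split[OF assms F(1) E(1)] norm_triangle_ineq by metis
      also have "\<dots> \<le> B1 + B2"
        using F E by (intro add_mono B) auto
      finally show False
        using F by simp
    qed
    then show ?thesis
      using nD nE E(2) by blast
  qed
  show ?thesis
  proof (cases "unb UNIV")
    case False
    then obtain B where "\<And>E. E \<in> sets borel \<Longrightarrow> \<not> norm (\<mu> E) > B"
      unfolding unb_def by auto
    then show ?thesis
      using that by (meson not_less)
  next
    case True
    have "\<exists>A. \<forall>n. unb (A n) \<and> (A (Suc n) \<subseteq> A n \<and> norm (\<mu> (A n - A (Suc n))) \<ge> 1)"
      by (rule dependent_nat_choice) (use True step in blast)+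
    then obtain A where A: "\<And>n::nat. unb (A n)"
      "\<And>n. A (Suc n) \<subseteq> A n \<and> norm (\<mu> (A n - A (Suc n))) \<ge> 1"
      by auto
    have mono: "A n \<subseteq> A m" if "m \<le> n" for m n
      using that A(2) by (simp add: lift_Suc_antimono_le)
    have "(\<lambda>n. \<mu> (A n - A (Suc n))) sums \<mu> (\<Union>n. A n - A (Suc n))"
    proof (rule vector_measure_sums[OF assms])
      show "A n - A (Suc n) \<in> sets borel" for n
        using A(1) by (auto simp: unb_def)
      have "(A m - A (Suc m)) \<inter> (A n - A (Suc n)) = {}" if "m < n" for m n
        using mono[of "Suc m" n] that by auto
      then show "disjoint_family (\<lambda>n. A n - A (Suc n))"
        by (auto simp: disjoint_family_on_def linorder_neq_iff)
    qed
    then have "(\<lambda>n. norm (\<mu> (A n - A (Suc n)))) \<longlonglongrightarrow> 0"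
      using sums_summable summable_LIMSEQ_zero tendsto_norm_zero by blast
    then have "eventually (\<lambda>n. norm (\<mu> (A n - A (Suc n))) < 1) sequentially"
      by (rule order_tendstoD) simp
    then obtain n where "norm (\<mu> (A n - A (Suc n))) < 1"
      by (auto simp: eventually_sequentially)
    then show ?thesis
      using A(2)[of n] by simp
  qed
qed

section \<open>Jordan decomposition\<close>

lemma jordan_pos_upper:
  fixes c :: "'a::topological_space set \<Rightarrow> real"
  assumes "vector_measure c" "E \<in> sets borel" "E \<subseteq> A"
  shows "c E \<le> jordan_pos c A"
proof -
  obtain B where "\<And>E. E \<in> sets borel \<Longrightarrow> norm (c E) \<le> B"
    using vector_measure_bounded[OF assms(1)] by blast
  then have "\<And>E. E \<in> sets borel \<Longrightarrow> c E \<le> B"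
    by (simp add: abs_le_D1)
  then have "bdd_above {c E | E. E \<in> sets borel \<and> E \<subseteq> A}"
    by (intro bdd_aboveI[of _ B]) auto
  then show ?thesis
    unfolding jordan_pos_def using assms by (intro cSup_upper) auto
qed

lemma jordan_pos_least:
  assumes "\<And>E. E \<in> sets borel \<Longrightarrow> E \<subseteq> A \<Longrightarrow> c E \<le> b"
  shows "jordan_pos c A \<le> b"
  unfolding jordan_pos_def using assms by (intro cSup_least) auto

lemma jordan_pos_nonneg:
  assumes "vector_measure c"
  shows "0 \<le> jordan_pos c A"
  using jordan_pos_upper[OF assms, of "{}" A] vector_measure_empty[OF assms] by simp

text \<open>Passing from a subset \<open>E\<close> of \<open>A\<close> to \<open>A - E\<close> turns
  \<open>c E\<close> into \<open>c A - c E\<close>, so the suprema of \<open>c\<close> and of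
  \<open>- c\<close> over subsets of \<open>A\<close> differ by exactly \<open>c A\<close>.\<close>

lemma jordan_pos_diff:
  assumes "vector_measure c" "A \<in> sets borel"
  shows "jordan_pos c A - jordan_pos (\<lambda>A. - c A) A = c A"
proof -
  note D = vector_measure_Diff[OF assms]
  have "jordan_pos c A \<le> c A + jordan_pos (\<lambda>A. - c A) A"
  proof (rule jordan_pos_least)
    fix E assume "E \<in> sets borel" "E \<subseteq> A"
    then show "c E \<le> c A + jordan_pos (\<lambda>A. - c A) A"
      using jordan_pos_upper[OF vector_measure_uminus[OF assms(1)], of "A - E" A] D assms by simp
  qed
  moreover have "jordan_pos (\<lambda>A. - c A) A \<le> jordan_pos c A - c A"
  proof (rule jordan_pos_least)
    fix E assume "E \<in> sets borel" "E \<subseteq> A"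
    then show "- c E \<le> jordan_pos c A - c A"
      using jordan_pos_upper[OF assms(1), of "A - E" A] D assms by simp
  qed
  ultimately show ?thesis by simp
qed

lemma jordan_pos_superadd:
  assumes c: "vector_measure c" and "A \<in> sets borel" "B \<in> sets borel" and "A \<inter> B = {}"
  shows "jordan_pos c A + jordan_pos c B \<le> jordan_pos c (A \<union> B)"
proof -
  have "jordan_pos c A \<le> jordan_pos c (A \<union> B) - jordan_pos c B"
  proof (rule jordan_pos_least)
    fix E assume E: "E \<in> sets borel" "E \<subseteq> A"
    have "jordan_pos c B \<le> jordan_pos c (A \<union> B) - c E"
    proof (rule jordan_pos_least)
      fix F assume F: "F \<in> sets borel" "F \<subseteq> B"
      have "c (E \<union> F) = c E + c F"
        by (rule vector_measure_Un) (use E F assms in auto)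
      moreover have "c (E \<union> F) \<le> jordan_pos c (A \<union> B)"
        by (rule jordan_pos_upper) (use E F assms in auto)
      ultimately show "c F \<le> jordan_pos c (A \<union> B) - c E" by simp
    qed
    then show "c E \<le> jordan_pos c (A \<union> B) - jordan_pos c B" by simp
  qed
  then show ?thesis by simp
qed

lemma jordan_pos_mono:
  assumes "vector_measure c" "A \<subseteq> B"
  shows "jordan_pos c A \<le> jordan_pos c B"
  by (rule jordan_pos_least) (use assms in \<open>auto intro: jordan_pos_upper\<close>)

text \<open>Superadditivity bounds every partial sum by the value on the union, which gives
  summability and one inequality. For the other, an arbitrary subset of the union is cut along the
  \<open>A n\<close>.\<close>

lemma jordan_pos_sums:
  assumes c: "vector_measure c" and A: "\<And>n. A n \<in> sets borel" "disjoint_family A"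
  shows "(\<lambda>n::nat. jordan_pos c (A n)) sums jordan_pos c (\<Union>n. A n)"
proof -
  have le: "(\<Sum>i<n. jordan_pos c (A i)) \<le> jordan_pos c (\<Union>i<n. A i)" for n
  proof (induction n)
    case 0
    then show ?case by (simp add: jordan_pos_nonneg[OF c])
  next
    case (Suc n)
    have "jordan_pos c (\<Union>i<n. A i) + jordan_pos c (A n) \<le> jordan_pos c ((\<Union>i<n. A i) \<union> A n)"
    proof (rule jordan_pos_superadd[OF c])
      show "(\<Union>i<n. A i) \<inter> A n = {}"
        using disjoint_family_onD[OF A(2), of _ n] by fastforce
    qed (use A in auto)
    then show ?case
      using Suc by (simp add: lessThan_Suc Un_commute)
  qed
  have le': "(\<Sum>i<n. jordan_pos c (A i)) \<le> jordan_pos c (\<Union>n. A n)" for n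
    using le[of n] jordan_pos_mono[OF c, of "\<Union>i<n. A i" "\<Union>n. A n"] by force
  have sm: "summable (\<lambda>n. jordan_pos c (A n))"
    by (rule summableI_nonneg_bounded[OF _ le']) (rule jordan_pos_nonneg[OF c])
  have "jordan_pos c (\<Union>n. A n) \<le> (\<Sum>n. jordan_pos c (A n))"
  proof (rule jordan_pos_least)
    fix E assume E: "E \<in> sets borel" "E \<subseteq> (\<Union>n. A n)"
    have "(\<lambda>n. c (E \<inter> A n)) sums c (\<Union>n. E \<inter> A n)"
      by (rule vector_measure_sums[OF c]) (use A E in \<open>auto simp: disjoint_family_on_def\<close>)
    moreover have "(\<Union>n. E \<inter> A n) = E"
      using E by auto
    ultimately have "(\<lambda>n. c (E \<inter> A n)) sums c E" by simp
    then show "c E \<le> (\<Sum>n. jordan_pos c (A n))"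
      by (rule sums_le[OF _ _ summable_sums[OF sm], rotated])
        (use A E in \<open>auto intro: jordan_pos_upper[OF c]\<close>)
  qed
  moreover have "(\<Sum>n. jordan_pos c (A n)) \<le> jordan_pos c (\<Union>n. A n)"
    by (rule suminf_le_const[OF sm le'])
  ultimately show ?thesis
    using sm by (simp add: sums_iff)
qed

lemma
  shows sets_jordan_pos_measure [simp, measurable_cong]: "sets (jordan_pos_measure c) = sets borel"
    and space_jordan_pos_measure [simp]: "space (jordan_pos_measure c) = UNIV"
  unfolding jordan_pos_measure_def
  using sets.sigma_sets_eq[of borel] by (simp_all add: sets_measure_of_conv space_measure_of_conv)

text \<open>From here on \<open>jordan_pos c\<close> is a genuine finite measure, so that the two
  integrals in \<open>signed_integral\<close> obey the usual rules.\<close>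

lemma emeasure_jordan_pos_measure:
  assumes c: "vector_measure c" and "A \<in> sets borel"
  shows "emeasure (jordan_pos_measure c) A = ennreal (jordan_pos c A)"
proof (rule emeasure_measure_of[OF jordan_pos_measure_def])
  have "jordan_pos c {} \<le> 0"
    by (rule jordan_pos_least) (simp add: vector_measure_empty[OF c])
  then show "positive (sets (jordan_pos_measure c)) (\<lambda>A. ennreal (jordan_pos c A))"
    by (simp add: positive_def ennreal_neg)
  show "countably_additive (sets (jordan_pos_measure c)) (\<lambda>A. ennreal (jordan_pos c A))"
  proof (rule countably_additiveI)
    fix A :: "nat \<Rightarrow> _ set"
    assume "range A \<subseteq> sets (jordan_pos_measure c)" "disjoint_family A"
    then have "(\<lambda>n. jordan_pos c (A n)) sums jordan_pos c (\<Union>n. A n)"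
      by (intro jordan_pos_sums[OF c]) auto
    then show "(\<Sum>i. ennreal (jordan_pos c (A i))) = ennreal (jordan_pos c (\<Union>i. A i))"
      using jordan_pos_nonneg[OF c]
      by (intro sums_unique[symmetric]) simp
  qed
qed (use assms in auto)

lemma measure_jordan_pos_measure:
  assumes "vector_measure c" and "A \<in> sets borel"
  shows "measure (jordan_pos_measure c) A = jordan_pos c A"
  by (simp add: measure_def emeasure_jordan_pos_measure[OF assms] jordan_pos_nonneg[OF assms(1)])

lemma finite_measure_jordan_pos_measure:
  assumes "vector_measure c"
  shows "finite_measure (jordan_pos_measure c)"
  by standard (simp add: emeasure_jordan_pos_measure[OF assms])

section \<open>The dominating measure\<close>

text \<open>The sum of the positive and negative parts of all coordinates: one finite positive
  measure that dominates \<open>norm (\<mu> A)\<close>. Regularity and all error estimates refer to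
  it; countable additivity is inherited from the summands.\<close>

definition l1_variation :: "('a::topological_space set \<Rightarrow> 'v::euclidean_space) \<Rightarrow> 'a measure" where
  "l1_variation \<mu> = measure_of UNIV (sets borel)
     (\<lambda>A. \<Sum>b\<in>Basis. emeasure (jordan_pos_measure (\<lambda>A. \<mu> A \<bullet> b)) A
                    + emeasure (jordan_pos_measure (\<lambda>A. - (\<mu> A \<bullet> b))) A)"

lemma
  shows sets_l1_variation [simp, measurable_cong]: "sets (l1_variation \<mu>) = sets borel"
    and space_l1_variation [simp]: "space (l1_variation \<mu>) = UNIV"
  unfolding l1_variation_def
  using sets.sigma_sets_eq[of borel] by (simp_all add: sets_measure_of_conv space_measure_of_conv)

lemma emeasure_l1_variation:
  assumes "A \<in> sets borel"
  shows "emeasure (l1_variation \<mu>) A =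
    (\<Sum>b\<in>Basis. emeasure (jordan_pos_measure (\<lambda>A. \<mu> A \<bullet> b)) A
               + emeasure (jordan_pos_measure (\<lambda>A. - (\<mu> A \<bullet> b))) A)"
proof (rule emeasure_measure_of[OF l1_variation_def])
  show "countably_additive (sets (l1_variation \<mu>))
     (\<lambda>A. \<Sum>b\<in>Basis. emeasure (jordan_pos_measure (\<lambda>A. \<mu> A \<bullet> b)) A
                    + emeasure (jordan_pos_measure (\<lambda>A. - (\<mu> A \<bullet> b))) A)"
  proof (rule countably_additiveI)
    fix A :: "nat \<Rightarrow> 'a set"
    assume A: "range A \<subseteq> sets (l1_variation \<mu>)" "disjoint_family A"
    have "(\<Sum>i. emeasure (jordan_pos_measure c) (A i)) = emeasure (jordan_pos_measure c) (\<Union>i. A i)" for c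
      using A by (intro suminf_emeasure) auto
    then show "(\<Sum>i. \<Sum>b\<in>Basis. emeasure (jordan_pos_measure (\<lambda>A. \<mu> A \<bullet> b)) (A i)
                    + emeasure (jordan_pos_measure (\<lambda>A. - (\<mu> A \<bullet> b))) (A i)) =
       (\<Sum>b\<in>Basis. emeasure (jordan_pos_measure (\<lambda>A. \<mu> A \<bullet> b)) (\<Union>i. A i)
                    + emeasure (jordan_pos_measure (\<lambda>A. - (\<mu> A \<bullet> b))) (\<Union>i. A i))"
      by (subst suminf_sum) (simp_all add: suminf_add[symmetric])
  qed
qed (use assms in \<open>auto simp: positive_def\<close>)

lemma vector_measure_neg_inner:
  fixes \<mu> :: "'a::topological_space set \<Rightarrow> 'v::real_inner"
  assumes "vector_measure \<mu>"
  shows "vector_measure (\<lambda>A. - (\<mu> A \<bullet> x))"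
  by (intro vector_measure_uminus vector_measure_inner assms)

lemma
  assumes "vector_measure \<mu>"
  shows measure_l1_variation: "A \<in> sets borel \<Longrightarrow> measure (l1_variation \<mu>) A =
      (\<Sum>b\<in>Basis. jordan_pos (\<lambda>A. \<mu> A \<bullet> b) A + jordan_pos (\<lambda>A. - (\<mu> A \<bullet> b)) A)"
    and finite_measure_l1_variation: "finite_measure (l1_variation \<mu>)"
proof -
  note v = vector_measure_inner[OF assms] vector_measure_neg_inner[OF assms]
  have e: "emeasure (l1_variation \<mu>) A =
      ennreal (\<Sum>b\<in>Basis. jordan_pos (\<lambda>A. \<mu> A \<bullet> b) A + jordan_pos (\<lambda>A. - (\<mu> A \<bullet> b)) A)"
    if "A \<in> sets borel" for A
    unfolding emeasure_l1_variation[OF that]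
    by (simp add: emeasure_jordan_pos_measure v that jordan_pos_nonneg flip: ennreal_plus)
  then show "A \<in> sets borel \<Longrightarrow> measure (l1_variation \<mu>) A =
      (\<Sum>b\<in>Basis. jordan_pos (\<lambda>A. \<mu> A \<bullet> b) A + jordan_pos (\<lambda>A. - (\<mu> A \<bullet> b)) A)"
    by (simp add: measure_def jordan_pos_nonneg v sum_nonneg)
  show "finite_measure (l1_variation \<mu>)"
    by standard (simp add: e)
qed

lemma norm_le_l1_variation:
  assumes "vector_measure \<mu>" "A \<in> sets borel"
  shows "norm (\<mu> A) \<le> measure (l1_variation \<mu>) A"
proof -
  note v = vector_measure_inner[OF assms(1)] vector_measure_neg_inner[OF assms(1)]
  have "norm (\<mu> A) \<le> (\<Sum>b\<in>Basis. \<bar>\<mu> A \<bullet> b\<bar>)"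
    by (rule norm_le_l1)
  also have "\<dots> \<le> (\<Sum>b\<in>Basis. jordan_pos (\<lambda>A. \<mu> A \<bullet> b) A + jordan_pos (\<lambda>A. - (\<mu> A \<bullet> b)) A)"
  proof (rule sum_mono)
    fix b
    show "\<bar>\<mu> A \<bullet> b\<bar> \<le> jordan_pos (\<lambda>A. \<mu> A \<bullet> b) A + jordan_pos (\<lambda>A. - (\<mu> A \<bullet> b)) A"
      using jordan_pos_upper[OF v(1), of A A b] jordan_pos_upper[OF v(2), of A A b] assms(2)
        jordan_pos_nonneg[OF v(1), of b A] jordan_pos_nonneg[OF v(2), of b A] by simp
  qed
  also have "\<dots> = measure (l1_variation \<mu>) A"
    using measure_l1_variation[OF assms] by simp
  finally show ?thesis .
qed

section \<open>Total variation\<close>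

lemma seminorm_triangle: "seminorm N \<Longrightarrow> N (x + y) \<le> N x + N y"
  and seminorm_scaleR: "seminorm N \<Longrightarrow> N (c *\<^sub>R x) = \<bar>c\<bar> * N x"
  by (simp_all add: seminorm_def)

lemma seminorm_zero: "seminorm N \<Longrightarrow> N 0 = 0"
  using seminorm_scaleR[of N 0 0] by simp

lemma seminorm_minus: "seminorm N \<Longrightarrow> N (- x) = N x"
  using seminorm_scaleR[of N "-1" x] by simp

lemma seminorm_nonneg: "seminorm N \<Longrightarrow> 0 \<le> N x"
  using seminorm_triangle[of N x "- x"] seminorm_minus[of N x] seminorm_zero[of N] by simp

lemma seminorm_sum: "seminorm N \<Longrightarrow> N (\<Sum>i\<in>I. f i) \<le> (\<Sum>i\<in>I. N (f i))"
  by (induction I rule: infinite_finite_induct)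
    (auto simp: seminorm_zero intro: order_trans[OF seminorm_triangle])

lemma seminorm_diff: "seminorm N \<Longrightarrow> \<bar>N x - N y\<bar> \<le> N (x - y)"
  using seminorm_triangle[of N "x - y" y] seminorm_triangle[of N "y - x" x]
    seminorm_minus[of N "x - y"] by simp

lemma seminorm_norm: "seminorm norm"
  by (simp add: seminorm_def norm_triangle_ineq)

lemma seminorm_inner: "seminorm (\<lambda>w::'v::real_inner. \<bar>w \<bullet> x\<bar>)"
  by (simp add: seminorm_def inner_add_left abs_triangle_ineq abs_mult)

lemma seminorm_le_norm:
  fixes N :: "'v::euclidean_space \<Rightarrow> real"
  assumes "seminorm N"
  obtains C where "C \<ge> 0" "\<And>x. N x \<le> C * norm x"
proof
  show "0 \<le> (\<Sum>b\<in>Basis. N b)"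
    by (intro sum_nonneg seminorm_nonneg assms)
  fix x :: 'v
  have "N x = N (\<Sum>b\<in>Basis. (x \<bullet> b) *\<^sub>R b)"
    by (simp add: euclidean_representation)
  also have "\<dots> \<le> (\<Sum>b\<in>Basis. N ((x \<bullet> b) *\<^sub>R b))"
    by (rule seminorm_sum[OF assms])
  also have "\<dots> \<le> (\<Sum>b\<in>Basis. N b * norm x)"
    by (intro sum_mono)
      (simp add: seminorm_scaleR[OF assms] mult.commute mult_left_mono Basis_le_norm seminorm_nonneg[OF assms])
  finally show "N x \<le> (\<Sum>b\<in>Basis. N b) * norm x"
    by (simp add: sum_distrib_right)
qed

text \<open>\<open>real_of_ereal\<close> sends infinite values to 0, so this copy is faithful only
  once finiteness is known; the bound by \<open>l1_variation\<close> supplies it.\<close>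

definition tv :: "('v::euclidean_space \<Rightarrow> real) \<Rightarrow> ('a::topological_space set \<Rightarrow> 'v) \<Rightarrow> 'a set \<Rightarrow> real" where
  "tv N \<mu> A = real_of_ereal (total_variation N \<mu> A)"

lemma sum_le_l1_variation:
  assumes \<mu>: "vector_measure \<mu>" and N: "\<And>x. N x \<le> C * norm x" and C: "C \<ge> 0"
    and I: "finite I" "disjoint_family_on E I" "\<And>i. i \<in> I \<Longrightarrow> E i \<in> sets borel" "\<And>i. i \<in> I \<Longrightarrow> E i \<subseteq> A"
    and A: "A \<in> sets borel"
  shows "(\<Sum>i\<in>I. N (\<mu> (E i))) \<le> C * measure (l1_variation \<mu>) A"
proof -
  interpret finite_measure "l1_variation \<mu>"
    by (rule finite_measure_l1_variation[OF \<mu>])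
  have "(\<Sum>i\<in>I. N (\<mu> (E i))) \<le> (\<Sum>i\<in>I. C * measure (l1_variation \<mu>) (E i))"
    by (intro sum_mono order_trans[OF N] mult_left_mono C norm_le_l1_variation \<mu> I)
  also have "\<dots> = C * measure (l1_variation \<mu>) (\<Union>i\<in>I. E i)"
    using I by (subst finite_measure_finite_Union) (auto simp: sum_distrib_left)
  also have "\<dots> \<le> C * measure (l1_variation \<mu>) A"
    using I A by (intro mult_left_mono C finite_measure_mono) auto
  finally show ?thesis .
qed

lemma
  assumes \<mu>: "vector_measure \<mu>" and N: "seminorm N" and A: "A \<in> sets borel"
  shows total_variation_eq_tv: "total_variation N \<mu> A = ereal (tv N \<mu> A)"
    and tv_nonneg: "0 \<le> tv N \<mu> A"
proof -
  obtain C where C: "C \<ge> 0" "\<And>x. N x \<le> C * norm x"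
    using seminorm_le_norm[OF N] by blast
  have "total_variation N \<mu> A \<le> ereal (C * measure (l1_variation \<mu>) A)"
    unfolding total_variation_def
    by (rule SUP_least) (use A in \<open>force intro!: sum_le_l1_variation \<mu> C\<close>)
  moreover have "0 \<le> total_variation N \<mu> A"
    unfolding total_variation_def
    by (rule SUP_upper2[of "(0, \<lambda>_. {})"]) (auto simp: disjoint_family_on_def)
  ultimately show "total_variation N \<mu> A = ereal (tv N \<mu> A)" "0 \<le> tv N \<mu> A"
    unfolding tv_def by (cases "total_variation N \<mu> A"; simp)+
qed

text \<open>Reindexing by a bijection frees later arguments from initial segments of the naturals:
  level sets are indexed by integers, merged families by a sum type.\<close>

lemma tv_upper:
  assumes \<mu>: "vector_measure \<mu>" and N: "seminorm N" and A: "A \<in> sets borel"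
    and I: "finite I" "disjoint_family_on E I" "\<And>i. i \<in> I \<Longrightarrow> E i \<in> sets borel" "\<And>i. i \<in> I \<Longrightarrow> E i \<subseteq> A"
  shows "(\<Sum>i\<in>I. N (\<mu> (E i))) \<le> tv N \<mu> A"
proof -
  obtain h where h: "bij_betw h {..<card I} I"
    using ex_bij_betw_nat_finite[OF I(1)] by (auto simp: atLeast0LessThan)
  have hI: "h i \<in> I" if "i < card I" for i
    using h that by (auto simp: bij_betw_def)
  have "ereal (\<Sum>i<card I. N (\<mu> (E (h i)))) \<le> total_variation N \<mu> A"
    unfolding total_variation_def
  proof (rule SUP_upper2)
    have "disjoint_family_on (\<lambda>i. E (h i)) {..<card I}"
      unfolding disjoint_family_on_def
    proof (intro ballI impI)
      fix i j assume "i \<in> {..<card I}" "j \<in> {..<card I}" "i \<noteq> j"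
      then have "h i \<noteq> h j" "h i \<in> I" "h j \<in> I"
        using h hI by (auto simp: bij_betw_def inj_on_def)
      then show "E (h i) \<inter> E (h j) = {}"
        using I(2) by (auto simp: disjoint_family_on_def)
    qed
    then show "(card I, \<lambda>i. E (h i)) \<in> {(m, E). disjoint_family_on E {..<m} \<and> (\<forall>i<m. E i \<in> sets borel \<and> E i \<subseteq> A)}"
      using I(3,4) hI by blast
  qed simp
  also have "(\<Sum>i<card I. N (\<mu> (E (h i)))) = (\<Sum>i\<in>I. N (\<mu> (E i)))"
    by (rule sum.reindex_bij_betw[OF h])
  finally show ?thesis
    by (simp add: total_variation_eq_tv[OF \<mu> N A])
qed

lemma tv_least:
  assumes \<mu>: "vector_measure \<mu>" and N: "seminorm N" and A: "A \<in> sets borel"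
    and le: "\<And>m E. disjoint_family_on E {..<m} \<Longrightarrow> (\<And>i::nat. i < m \<Longrightarrow> E i \<in> sets borel) \<Longrightarrow>
      (\<And>i. i < m \<Longrightarrow> E i \<subseteq> A) \<Longrightarrow> (\<Sum>i<m. N (\<mu> (E i))) \<le> b"
  shows "tv N \<mu> A \<le> b"
proof -
  have "total_variation N \<mu> A \<le> ereal b"
    unfolding total_variation_def by (rule SUP_least) (force intro!: le)
  then show ?thesis
    by (simp add: total_variation_eq_tv[OF \<mu> N A])
qed

lemma tv_approx:
  assumes \<mu>: "vector_measure \<mu>" and N: "seminorm N" and A: "A \<in> sets borel" and b: "b < tv N \<mu> A"
  obtains m :: nat and E where "disjoint_family_on E {..<m}" "\<And>i. i < m \<Longrightarrow> E i \<in> sets borel"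
    "\<And>i. i < m \<Longrightarrow> E i \<subseteq> A" "b < (\<Sum>i<m. N (\<mu> (E i)))"
  using tv_least[OF \<mu> N A, of b] b by (meson not_less)

lemma tv_le_l1_variation:
  assumes "vector_measure \<mu>" "seminorm N" "A \<in> sets borel" "C \<ge> 0" "\<And>x. N x \<le> C * norm x"
  shows "tv N \<mu> A \<le> C * measure (l1_variation \<mu>) A"
  using assms by (intro tv_least sum_le_l1_variation) auto

lemma tv_mono:
  assumes "vector_measure \<mu>" "seminorm N" "A \<in> sets borel" "B \<in> sets borel" "A \<subseteq> B"
  shows "tv N \<mu> A \<le> tv N \<mu> B"
  by (rule tv_least[OF assms(1-3)], rule tv_upper[OF assms(1,2,4)]) (use assms in auto)

lemma seminorm_le_tv:
  assumes "vector_measure \<mu>" "seminorm N" "A \<in> sets borel"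
  shows "N (\<mu> A) \<le> tv N \<mu> A"
  using tv_upper[OF assms, of "{()}" "\<lambda>_. A"] assms by (simp add: disjoint_family_on_def)

text \<open>Each piece is cut along \<open>A\<close>, and what remains lies in \<open>B\<close>. The
  two sets may overlap, as the closed cells in the upper bound do where distances tie.\<close>

lemma tv_subadd:
  assumes \<mu>: "vector_measure \<mu>" and N: "seminorm N" and AB: "A \<in> sets borel" "B \<in> sets borel"
  shows "tv N \<mu> (A \<union> B) \<le> tv N \<mu> A + tv N \<mu> B"
proof (rule tv_least[OF \<mu> N])
  fix m :: nat and E
  assume E: "disjoint_family_on E {..<m}" "\<And>i. i < m \<Longrightarrow> E i \<in> sets borel" "\<And>i. i < m \<Longrightarrow> E i \<subseteq> A \<union> B"
  have "(\<Sum>i<m. N (\<mu> (E i))) \<le> (\<Sum>i<m. N (\<mu> (E i \<inter> A)) + N (\<mu> (E i - A)))"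
  proof (rule sum_mono)
    fix i assume "i \<in> {..<m}"
    then show "N (\<mu> (E i)) \<le> N (\<mu> (E i \<inter> A)) + N (\<mu> (E i - A))"
      using vector_measure_split[OF \<mu> E(2) AB(1), of i] seminorm_triangle[OF N] by simp
  qed
  also have "\<dots> = (\<Sum>i<m. N (\<mu> (E i \<inter> A))) + (\<Sum>i<m. N (\<mu> (E i - A)))"
    by (rule sum.distrib)
  also have "\<dots> \<le> tv N \<mu> A + tv N \<mu> B"
  proof (intro add_mono)
    show "(\<Sum>i<m. N (\<mu> (E i \<inter> A))) \<le> tv N \<mu> A"
      by (rule tv_upper[OF \<mu> N AB(1)]) (use E AB in \<open>auto simp: disjoint_family_on_def\<close>)
    show "(\<Sum>i<m. N (\<mu> (E i - A))) \<le> tv N \<mu> B"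
      by (rule tv_upper[OF \<mu> N AB(2)]) (use E AB in \<open>fastforce simp: disjoint_family_on_def\<close>)+
  qed
  finally show "(\<Sum>i<m. N (\<mu> (E i))) \<le> tv N \<mu> A + tv N \<mu> B" .
qed (use AB in auto)

lemma tv_subadd_UN:
  assumes \<mu>: "vector_measure \<mu>" and N: "seminorm N" and "finite I" "\<And>i. i \<in> I \<Longrightarrow> A i \<in> sets borel"
  shows "tv N \<mu> (\<Union>i\<in>I. A i) \<le> (\<Sum>i\<in>I. tv N \<mu> (A i))"
  using assms(3,4)
proof (induction I)
  case empty
  have "tv N \<mu> {} \<le> 0"
    by (rule tv_least[OF \<mu> N]) (auto simp: vector_measure_empty[OF \<mu>] seminorm_zero[OF N])
  then show ?case by simp
next
  case (insert j I)
  have "tv N \<mu> (A j \<union> (\<Union>i\<in>I. A i)) \<le> tv N \<mu> (A j) + tv N \<mu> (\<Union>i\<in>I. A i)"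
    using insert by (intro tv_subadd \<mu> N) auto
  with insert show ?case by simp
qed

lemma tv_superadd:
  assumes \<mu>: "vector_measure \<mu>" and N: "seminorm N" and AB: "A \<in> sets borel" "B \<in> sets borel"
    and disj: "A \<inter> B = {}"
  shows "tv N \<mu> A + tv N \<mu> B \<le> tv N \<mu> (A \<union> B)"
proof -
  have "tv N \<mu> A \<le> tv N \<mu> (A \<union> B) - tv N \<mu> B"
  proof (rule tv_least[OF \<mu> N AB(1)])
    fix m :: nat and E
    assume E: "disjoint_family_on E {..<m}" "\<And>i. i < m \<Longrightarrow> E i \<in> sets borel" "\<And>i. i < m \<Longrightarrow> E i \<subseteq> A"
    have "tv N \<mu> B \<le> tv N \<mu> (A \<union> B) - (\<Sum>i<m. N (\<mu> (E i)))"
    proof (rule tv_least[OF \<mu> N AB(2)])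
      fix k :: nat and F
      assume F: "disjoint_family_on F {..<k}" "\<And>i. i < k \<Longrightarrow> F i \<in> sets borel" "\<And>i. i < k \<Longrightarrow> F i \<subseteq> B"
      \<comment> \<open>The families in \<open>A\<close> and in \<open>B\<close> are merged into
        one, indexed by the disjoint sum of their index sets.\<close>
      have "(\<Sum>z\<in>{..<m} <+> {..<k}. N (\<mu> (case_sum E F z))) \<le> tv N \<mu> (A \<union> B)"
      proof (rule tv_upper[OF \<mu> N])
        have "E i \<inter> F j = {}" if "i < m" "j < k" for i j
          using E(3)[OF that(1)] F(3)[OF that(2)] disj by auto
        then show "disjoint_family_on (case_sum E F) ({..<m} <+> {..<k})"
          using disjoint_family_onD[OF E(1)] disjoint_family_onD[OF F(1)]
          unfolding disjoint_family_on_def by (fastforce simp: Int_commute)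
      qed (use E F AB in \<open>fastforce split: sum.splits\<close>)+
      then show "(\<Sum>i<k. N (\<mu> (F i))) \<le> tv N \<mu> (A \<union> B) - (\<Sum>i<m. N (\<mu> (E i)))"
        by (simp add: sum.Plus)
    qed
    then show "(\<Sum>i<m. N (\<mu> (E i))) \<le> tv N \<mu> (A \<union> B) - tv N \<mu> B" by simp
  qed
  then show ?thesis by simp
qed

lemma tv_superadd_UN:
  assumes \<mu>: "vector_measure \<mu>" and N: "seminorm N" and "finite I" "\<And>i. i \<in> I \<Longrightarrow> A i \<in> sets borel"
    and "disjoint_family_on A I"
  shows "(\<Sum>i\<in>I. tv N \<mu> (A i)) \<le> tv N \<mu> (\<Union>i\<in>I. A i)"
  using assms(3-5)
proof (induction I)
  case empty
  then show ?case by (simp add: tv_nonneg[OF \<mu> N])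
next
  case (insert j I)
  have "tv N \<mu> (A j) + tv N \<mu> (\<Union>i\<in>I. A i) \<le> tv N \<mu> (A j \<union> (\<Union>i\<in>I. A i))"
    using insert by (intro tv_superadd \<mu> N) (auto simp: disjoint_family_on_def)
  with insert show ?case by (simp add: disjoint_family_on_def)
qed

section \<open>Integration against vector measures\<close>

lemma inner_vm_integral:
  "b \<in> Basis \<Longrightarrow> vm_integral \<mu> \<phi> \<bullet> b = signed_integral (\<lambda>A. \<mu> A \<bullet> b) \<phi>"
  unfolding vm_integral_def by simp

lemma integrable_jordan_pos_measure:
  fixes f :: "'a::topological_space \<Rightarrow> real"
  assumes "vector_measure c" "f \<in> borel_measurable borel" "\<And>x. \<bar>f x\<bar> \<le> B"
  shows "integrable (jordan_pos_measure c) f"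
proof -
  interpret finite_measure "jordan_pos_measure c"
    by (rule finite_measure_jordan_pos_measure[OF assms(1)])
  show ?thesis
    by (rule integrable_const_bound[of _ B])
      (use assms in \<open>auto simp: measurable_cong_sets[OF sets_jordan_pos_measure refl]\<close>)
qed

text \<open>Two uses shape the statement: \<open>D = UNIV\<close> with small \<open>e\<close>
  measures a uniform approximation, while \<open>e = 1\<close> with \<open>D\<close> of small mass
  measures the replacement of an indicator by a bump.\<close>

lemma vm_integral_diff_le:
  fixes f g :: "'a::topological_space \<Rightarrow> real" and \<mu> :: "'a set \<Rightarrow> 'v::euclidean_space"
  assumes \<mu>: "vector_measure \<mu>"
    and f: "f \<in> borel_measurable borel" "\<And>x. \<bar>f x\<bar> \<le> B"
    and g: "g \<in> borel_measurable borel" "\<And>x. \<bar>g x\<bar> \<le> B"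
    and D: "D \<in> sets borel" and e: "e \<ge> 0" and le: "\<And>x. \<bar>f x - g x\<bar> \<le> e * indicator D x"
  shows "norm (vm_integral \<mu> f - vm_integral \<mu> g) \<le> e * measure (l1_variation \<mu>) D"
proof -
  have J: "\<bar>integral\<^sup>L (jordan_pos_measure c) f - integral\<^sup>L (jordan_pos_measure c) g\<bar> \<le> e * jordan_pos c D"
    if c: "vector_measure c" for c
  proof -
    note int = integrable_jordan_pos_measure[OF c]
    have iD: "integrable (jordan_pos_measure c) (\<lambda>x. e * indicator D x)"
      by (rule int[of _ e]) (use D e in \<open>auto split: split_indicator\<close>)
    have "\<bar>integral\<^sup>L (jordan_pos_measure c) f - integral\<^sup>L (jordan_pos_measure c) g\<bar>
        = norm (\<integral>x. f x - g x \<partial>jordan_pos_measure c)"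
      by (simp add: Bochner_Integration.integral_diff[OF int[OF f] int[OF g]])
    also have "\<dots> \<le> (\<integral>x. norm (f x - g x) \<partial>jordan_pos_measure c)"
      by (rule integral_norm_bound)
    also have "\<dots> \<le> (\<integral>x. e * indicator D x \<partial>jordan_pos_measure c)"
      by (rule Bochner_Integration.integral_mono) (use iD int[OF f] int[OF g] le in auto)
    also have "\<dots> = e * jordan_pos c D"
      by (simp add: D measure_jordan_pos_measure[OF c D])
    finally show ?thesis .
  qed
  note v = vector_measure_inner[OF \<mu>] vector_measure_neg_inner[OF \<mu>]
  have "norm (vm_integral \<mu> f - vm_integral \<mu> g) \<le> (\<Sum>b\<in>Basis. \<bar>(vm_integral \<mu> f - vm_integral \<mu> g) \<bullet> b\<bar>)"
    by (rule norm_le_l1)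
  also have "\<dots> \<le> (\<Sum>b\<in>Basis. e * (jordan_pos (\<lambda>A. \<mu> A \<bullet> b) D + jordan_pos (\<lambda>A. - (\<mu> A \<bullet> b)) D))"
  proof (rule sum_mono)
    fix b :: 'v assume "b \<in> Basis"
    then show "\<bar>(vm_integral \<mu> f - vm_integral \<mu> g) \<bullet> b\<bar>
        \<le> e * (jordan_pos (\<lambda>A. \<mu> A \<bullet> b) D + jordan_pos (\<lambda>A. - (\<mu> A \<bullet> b)) D)"
      using J[OF v(1)[of b]] J[OF v(2)[of b]]
      by (simp add: inner_diff_left inner_vm_integral signed_integral_def distrib_left)
  qed
  also have "\<dots> = e * measure (l1_variation \<mu>) D"
    by (simp add: measure_l1_variation[OF \<mu> D] sum_distrib_left)
  finally show ?thesis .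
qed

text \<open>In each coordinate the integrals against the two Jordan parts recombine into the signed
  value by \<open>jordan_pos_diff\<close>; this ties the integral back to \<mu>.\<close>

lemma vm_integral_simple:
  fixes \<mu> :: "'a::topological_space set \<Rightarrow> 'v::euclidean_space" and a :: "'i \<Rightarrow> real"
  assumes \<mu>: "vector_measure \<mu>" and I: "finite I" "\<And>i. i \<in> I \<Longrightarrow> A i \<in> sets borel"
  shows "vm_integral \<mu> (\<lambda>x. \<Sum>i\<in>I. a i * indicator (A i) x) = (\<Sum>i\<in>I. a i *\<^sub>R \<mu> (A i))"
proof -
  have J: "integral\<^sup>L (jordan_pos_measure c) (\<lambda>x. \<Sum>i\<in>I. a i * indicator (A i) x) = (\<Sum>i\<in>I. a i * jordan_pos c (A i))"
    if c: "vector_measure c" for c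
  proof -
    have int: "integrable (jordan_pos_measure c) (\<lambda>x. a i * indicator (A i) x)" if "i \<in> I" for i
      by (rule integrable_jordan_pos_measure[OF c, of _ "\<bar>a i\<bar>"]) (use I that in \<open>auto split: split_indicator\<close>)
    show ?thesis
      by (subst Bochner_Integration.integral_sum)
        (use int I in \<open>auto intro!: sum.cong simp: measure_jordan_pos_measure[OF c]\<close>)
  qed
  show ?thesis
  proof (rule euclidean_eqI)
    fix b :: 'v assume b: "b \<in> Basis"
    have "vm_integral \<mu> (\<lambda>x. \<Sum>i\<in>I. a i * indicator (A i) x) \<bullet> b =
      (\<Sum>i\<in>I. a i * (jordan_pos (\<lambda>A. \<mu> A \<bullet> b) (A i) - jordan_pos (\<lambda>A. - (\<mu> A \<bullet> b)) (A i)))"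
      by (simp add: inner_vm_integral[OF b] signed_integral_def J vector_measure_inner[OF \<mu>]
        vector_measure_neg_inner[OF \<mu>] sum_subtractf right_diff_distrib)
    also have "\<dots> = (\<Sum>i\<in>I. a i *\<^sub>R \<mu> (A i)) \<bullet> b"
      using I by (simp add: jordan_pos_diff[OF vector_measure_inner[OF \<mu>]] inner_sum_left)
    finally show "vm_integral \<mu> (\<lambda>x. \<Sum>i\<in>I. a i * indicator (A i) x) \<bullet> b = (\<Sum>i\<in>I. a i *\<^sub>R \<mu> (A i)) \<bullet> b" .
  qed
qed

lemma vm_integral_indicator:
  assumes "vector_measure \<mu>" "A \<in> sets borel"
  shows "vm_integral \<mu> (indicator A) = \<mu> A"
  using vm_integral_simple[OF assms(1), of "{()}" "\<lambda>_. A" "\<lambda>_. 1"] assms(2) by simp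

text \<open>Approximate \<open>\<phi>\<close> uniformly by the simple function \<open>\<lfloor>k * \<phi>\<rfloor> / k\<close>, which still vanishes off \<open>U\<close>
  and still has absolute value at most 1.\<close>
lemma seminorm_vm_integral_le_tv:
  fixes \<phi> :: "'a::topological_space \<Rightarrow> real"
  assumes \<mu>: "vector_measure \<mu>" and N: "seminorm N" and U: "U \<in> sets borel"
    and \<phi>: "\<phi> \<in> borel_measurable borel" "\<And>x. \<bar>\<phi> x\<bar> \<le> 1" "\<And>x. x \<notin> U \<Longrightarrow> \<phi> x = 0"
  shows "N (vm_integral \<mu> \<phi>) \<le> tv N \<mu> U"
proof -
  obtain C where C: "C \<ge> 0" "\<And>x. N x \<le> C * norm x"
    using seminorm_le_norm[OF N] by blast
  have le: "N (vm_integral \<mu> \<phi>) \<le> tv N \<mu> U + C * measure (l1_variation \<mu>) UNIV * (1 / real (Suc n))" for n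
  proof -
    \<comment> \<open>An integer \<open>k\<close> keeps the floor of \<open>k * \<phi> x\<close>
      between \<open>- k\<close> and \<open>k\<close>, so that the coefficients \<open>j / k\<close>
      have absolute value at most 1.\<close>
    define k where "k = real (Suc n)"
    have k: "k > 0" by (simp add: k_def)
    \<comment> \<open>Level 0 is left out: it contributes nothing to the simple function, and every
      other level set lies in \<open>U\<close>, because \<phi> vanishes off
      \<open>U\<close>.\<close>
    define J where "J = {- int (Suc n)..int (Suc n)} - {0}"
    define E where "E j = {x. \<lfloor>k * \<phi> x\<rfloor> = j}" for j
    have E: "E j \<in> sets borel" for j
    proof -
      have "(\<lambda>x. k * \<phi> x) \<in> borel_measurable borel"
        using \<phi>(1) by simp
      then have "Measurable.pred borel (\<lambda>x. \<lfloor>k * \<phi> x\<rfloor> = j)"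
        by measurable
      then show ?thesis
        by (simp add: E_def pred_def)
    qed
    have fl: "\<lfloor>k * \<phi> x\<rfloor> \<in> {- int (Suc n)..int (Suc n)}" for x
    proof -
      have "\<bar>k * \<phi> x\<bar> \<le> k"
        using \<phi>(2)[of x] k by (simp add: abs_mult mult_le_cancel_left1)
      then have "- real_of_int (int (Suc n)) \<le> k * \<phi> x" "k * \<phi> x \<le> real_of_int (int (Suc n))"
        by (simp_all add: k_def abs_le_iff)
      then show ?thesis
        by (auto simp: le_floor_iff intro: floor_le_iff[THEN iffD2])
    qed
    define s where "s x = (\<Sum>j\<in>J. (of_int j / k) * indicator (E j) x)" for x
    have s: "s x = of_int \<lfloor>k * \<phi> x\<rfloor> / k" for x
    proof -
      have "s x = (\<Sum>j\<in>J. if j = \<lfloor>k * \<phi> x\<rfloor> then of_int j / k else 0)"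
        unfolding s_def by (intro sum.cong) (auto simp: E_def indicator_def)
      also have "\<dots> = of_int \<lfloor>k * \<phi> x\<rfloor> / k"
        using fl[of x] by (auto simp: J_def)
      finally show ?thesis .
    qed
    have s_meas: "s \<in> borel_measurable borel"
      unfolding s_def using E by measurable
    have s_bd: "\<bar>s x\<bar> \<le> 1" for x
    proof -
      have "\<bar>of_int \<lfloor>k * \<phi> x\<rfloor>\<bar> \<le> k"
        using fl[of x] unfolding k_def by (auto simp: abs_le_iff)
      then show ?thesis
        unfolding s using k by simp
    qed
    have close: "\<bar>\<phi> x - s x\<bar> \<le> (1 / k) * indicator UNIV x" for x
    proof -
      have "\<phi> x - s x = (k * \<phi> x - of_int \<lfloor>k * \<phi> x\<rfloor>) / k"
        unfolding s using k by (simp add: field_simps)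
      moreover have "\<bar>k * \<phi> x - of_int \<lfloor>k * \<phi> x\<rfloor>\<bar> \<le> 1"
        by linarith
      ultimately show ?thesis
        using k by (simp add: divide_right_mono)
    qed
    have "N (vm_integral \<mu> \<phi>) \<le> N (vm_integral \<mu> s) + N (vm_integral \<mu> \<phi> - vm_integral \<mu> s)"
      using seminorm_triangle[OF N, of "vm_integral \<mu> s" "vm_integral \<mu> \<phi> - vm_integral \<mu> s"] by simp
    moreover have "N (vm_integral \<mu> \<phi> - vm_integral \<mu> s) \<le> C * ((1 / k) * measure (l1_variation \<mu>) UNIV)"
      by (intro order_trans[OF C(2)] mult_left_mono C(1)
        vm_integral_diff_le[OF \<mu> \<phi>(1,2) s_meas s_bd _ _ close]) (use k in auto)
    moreover have "N (vm_integral \<mu> s) \<le> tv N \<mu> U"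
    proof -
      have "vm_integral \<mu> s = (\<Sum>j\<in>J. (of_int j / k) *\<^sub>R \<mu> (E j))"
        unfolding s_def by (rule vm_integral_simple[OF \<mu>]) (auto simp: J_def E)
      then have "N (vm_integral \<mu> s) \<le> (\<Sum>j\<in>J. N ((of_int j / k) *\<^sub>R \<mu> (E j)))"
        by (simp add: seminorm_sum[OF N])
      also have "\<dots> \<le> (\<Sum>j\<in>J. N (\<mu> (E j)))"
      proof (rule sum_mono)
        fix j assume "j \<in> J"
        then have "\<bar>of_int j / k\<bar> \<le> 1"
          using k by (auto simp: J_def k_def abs_le_iff)
        then show "N ((of_int j / k) *\<^sub>R \<mu> (E j)) \<le> N (\<mu> (E j))"
          unfolding seminorm_scaleR[OF N] by (rule mult_left_le_one_le[OF seminorm_nonneg[OF N] abs_ge_zero])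
      qed
      also have "\<dots> \<le> tv N \<mu> U"
      proof (rule tv_upper[OF \<mu> N U])
        show "E j \<subseteq> U" if "j \<in> J" for j
          using that \<phi>(3) by (force simp: E_def J_def)
      qed (use E in \<open>auto simp: J_def E_def disjoint_family_on_def\<close>)
      finally show ?thesis .
    qed
    ultimately show ?thesis
      by (simp add: k_def)
  qed
  have "(\<lambda>n. tv N \<mu> U + C * measure (l1_variation \<mu>) UNIV * (1 / real (Suc n)))
      \<longlonglongrightarrow> tv N \<mu> U + C * measure (l1_variation \<mu>) UNIV * 0"
    by (intro tendsto_intros LIMSEQ_Suc[OF lim_1_over_n])
  then show ?thesis
    using le by (intro LIMSEQ_le_const) auto
qed

section \<open>Regularity\<close>

lemma open_eq_Union_closed:
  fixes B :: "'a::metric_space set"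
  assumes "open B"
  obtains C :: "nat \<Rightarrow> 'a set" where "\<And>n. closed (C n)" "incseq C" "(\<Union>n. C n) = B"
proof (cases "B = UNIV")
  \<comment> \<open>The whole space is treated apart: its complement is empty and
    \<open>infdist x {} = 0\<close>, so the sets \<open>C n\<close> defined below would all be
    empty.\<close>
  case True
  then show ?thesis
    using that[of "\<lambda>_. UNIV"] by (auto simp: incseq_def)
next
  case False
  define C where "C n = {x. 1 / real (Suc n) \<le> infdist x (- B)}" for n
  have "closed (C n)" for n
    unfolding C_def by (intro closed_Collect_le continuous_intros)
  moreover have "incseq C"
    unfolding incseq_def
  proof (intro allI impI)
    fix m n :: nat assume "m \<le> n"
    then have "1 / real (Suc n) \<le> 1 / real (Suc m)"
      by (simp add: frac_le)
    then show "C m \<subseteq> C n"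
      by (auto simp: C_def)
  qed
  moreover have "(\<Union>n. C n) = B"
  proof (intro equalityI subsetI)
    fix x assume "x \<in> (\<Union>n. C n)"
    then obtain n where "1 / real (Suc n) \<le> infdist x (- B)"
      by (auto simp: C_def)
    then have "infdist x (- B) > 0"
      by (rule less_le_trans[rotated]) simp
    then show "x \<in> B"
      using infdist_zero[of x "- B"] by fastforce
  next
    fix x assume "x \<in> B"
    then have "infdist x (- B) > 0"
      using False assms by (intro infdist_pos_not_in_closed) auto
    then obtain n where "1 / real (Suc n) < infdist x (- B)"
      using nat_approx_posE by blast
    then show "x \<in> (\<Union>n. C n)"
      by (auto simp: C_def intro!: exI[of _ n])
  qed
  ultimately show ?thesis
    using that by blast
qed

context
  fixes M :: "'a::metric_space measure"
  assumes finite_M: "finite_measure M" and sets_M: "sets M = sets borel"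
begin

interpretation finite_measure M
  by (rule finite_M)

text \<open>Inner and outer approximation are carried through the induction together, since
  complementation exchanges them; it leaves the gap \<open>U - C\<close> unchanged as a set.\<close>

lemma closed_open_regular:
  assumes "B \<in> sets borel" "e > 0"
  shows "\<exists>C U. closed C \<and> open U \<and> C \<subseteq> B \<and> B \<subseteq> U \<and> measure M (U - C) < e"
proof -
  have "B \<in> sigma_sets UNIV {S. open S}"
    using assms(1) by (simp add: borel_def)
  then show ?thesis
    using assms(2)
  proof (induction arbitrary: e rule: sigma_sets.induct)
    case (Basic B)
    then have "open B" by simp
    then obtain C :: "nat \<Rightarrow> 'a set" where C: "\<And>n. closed (C n)" "incseq C" "(\<Union>n. C n) = B"
      using open_eq_Union_closed by blast
    have "(\<lambda>n. measure M (C n)) \<longlonglongrightarrow> measure M (\<Union>n. C n)"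
      by (rule finite_Lim_measure_incseq) (use C in \<open>auto simp: sets_M\<close>)
    then have "eventually (\<lambda>n. measure M B - e < measure M (C n)) sequentially"
      using Basic C(3) by (intro order_tendstoD) auto
    then obtain n where n: "measure M B - e < measure M (C n)"
      by (auto simp: eventually_sequentially)
    have "measure M (B - C n) = measure M B - measure M (C n)"
      by (rule finite_measure_Diff) (use C \<open>open B\<close> in \<open>auto simp: sets_M\<close>)
    then show ?case
      using n C \<open>open B\<close> by (intro exI[of _ "C n"] exI[of _ B]) auto
  next
    case Empty
    then show ?case
      by (intro exI[of _ "{}"]) auto
  next
    case (Compl B)
    then obtain C U where "closed C" "open U" "C \<subseteq> B" "B \<subseteq> U" "measure M (U - C) < e"
      by metis
    moreover have "(- C) - (- U) = U - C"
      by auto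
    ultimately show ?case
      by (intro exI[of _ "- U"] exI[of _ "- C"]) (auto simp: Compl_eq_Diff_UNIV[symmetric])
  next
    case (Union B)
    \<comment> \<open>Half of \<open>e\<close> is shared among the countably many gaps; the other
      half pays for truncating the union of the closed sets, which may fail to be closed, to a
      finite union.\<close>
    define d where "d n = e / 2 * (1 / 2) ^ Suc n" for n :: nat
    have d: "d n > 0" for n
      using Union.prems by (simp add: d_def)
    have "\<forall>n. \<exists>C U. closed C \<and> open U \<and> C \<subseteq> B n \<and> B n \<subseteq> U \<and> measure M (U - C) < d n"
      using Union.IH d by blast
    then obtain C U where CU: "\<And>n. closed (C n)" "\<And>n. open (U n)" "\<And>n. C n \<subseteq> B n" "\<And>n. B n \<subseteq> U n"
      "\<And>n. measure M (U n - C n) < d n"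
      unfolding choice_iff by blast
    have sC: "C n \<in> sets borel" "U n \<in> sets borel" for n
      using CU by auto
    define CC where "CC n = (\<Union>i\<le>n. C i)" for n
    have sCC: "CC n \<in> sets borel" for n
      unfolding CC_def using sC by auto
    have "(\<lambda>n. measure M (CC n)) \<longlonglongrightarrow> measure M (\<Union>n. CC n)"
      by (rule finite_Lim_measure_incseq)
        (use sCC in \<open>auto simp: sets_M incseq_def CC_def intro: order_trans\<close>)
    then have "eventually (\<lambda>n. measure M (\<Union>n. CC n) - e / 2 < measure M (CC n)) sequentially"
      using Union.prems by (intro order_tendstoD) auto
    then obtain n where n: "measure M (\<Union>n. CC n) - e / 2 < measure M (CC n)"
      by (auto simp: eventually_sequentially)
    have CCU: "(\<Union>n. CC n) = (\<Union>n. C n)"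
      by (auto simp: CC_def)
    have dsum: "d sums (e / 2)"
      using sums_mult[OF power_half_series, of "e / 2"] by (simp add: d_def[abs_def])
    have sm: "summable (\<lambda>i. measure M (U i - C i))"
      by (rule summable_comparison_test'[OF sums_summable[OF dsum], of 0])
        (use CU(5) in \<open>auto intro: less_imp_le\<close>)
    have "measure M ((\<Union>n. U n) - (\<Union>n. C n)) \<le> measure M (\<Union>n. U n - C n)"
      by (rule finite_measure_mono) (use sC in \<open>auto simp: sets_M\<close>)
    also have "\<dots> \<le> (\<Sum>i. measure M (U i - C i))"
      by (rule finite_measure_subadditive_countably) (use sC sm in \<open>auto simp: sets_M\<close>)
    also have "\<dots> \<le> (\<Sum>i. d i)"
      by (rule suminf_le[OF _ sm sums_summable[OF dsum]]) (use CU(5) in \<open>auto intro: less_imp_le\<close>)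
    also have "\<dots> = e / 2"
      using dsum by (simp add: sums_iff)
    finally have 1: "measure M ((\<Union>n. U n) - (\<Union>n. C n)) \<le> e / 2" .
    have "measure M ((\<Union>n. C n) - CC n) = measure M (\<Union>n. C n) - measure M (CC n)"
      by (rule finite_measure_Diff) (use sC sCC in \<open>auto simp: sets_M CC_def\<close>)
    then have 2: "measure M ((\<Union>n. C n) - CC n) < e / 2"
      using n CCU by simp
    have "measure M ((\<Union>n. U n) - CC n)
        \<le> measure M (((\<Union>n. U n) - (\<Union>n. C n)) \<union> ((\<Union>n. C n) - CC n))"
      by (rule finite_measure_mono) (use sC sCC in \<open>auto simp: sets_M\<close>)
    also have "\<dots> \<le> measure M ((\<Union>n. U n) - (\<Union>n. C n)) + measure M ((\<Union>n. C n) - CC n)"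
      by (rule measure_Un_le) (use sC sCC in \<open>auto simp: sets_M\<close>)
    finally have 3: "measure M ((\<Union>n. U n) - CC n) < e"
      using 1 2 by simp
    show ?case
    proof (intro exI conjI)
      show "closed (CC n)"
        unfolding CC_def using CU(1) by auto
      show "open (\<Union>n. U n)"
        using CU(2) by auto
      show "CC n \<subseteq> \<Union> (range B)" "\<Union> (range B) \<subseteq> (\<Union>n. U n)"
        using CU(3,4) by (fastforce simp: CC_def)+
    qed (rule 3)
  qed
qed

end

text \<open>Countably many closed balls, with centres in a countable dense set and radii
  \<open>1 / real (Suc n)\<close>, are available; local compactness ensures that the compact ones
  among them already cover the space.\<close>

lemma sigma_compact:
  assumes lc: "locally_compact_space (euclidean :: 'a::metric_space topology)"
    and sep: "separable_space (euclidean :: 'a::metric_space topology)"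
  obtains Q :: "nat \<Rightarrow> 'a::metric_space set" where "\<And>n. compact (Q n)" "incseq Q" "(\<Union>n. Q n) = UNIV"
proof -
  obtain S :: "'a set" where S: "countable S" "closure S = UNIV"
    using sep by (auto simp: separable_space_def)
  define P where "P = (\<lambda>(s, n). cball s (1 / real (Suc n))) ` (S \<times> UNIV) \<inter> Collect compact"
  have "countable P"
    unfolding P_def using S(1) by auto
  have cover: "\<exists>K\<in>P. x \<in> K" for x
  proof -
    obtain U K where UK: "open U" "compact K" "x \<in> U" "U \<subseteq> K"
      using lc unfolding locally_compact_space_def by (simp add: Bex_def) blast
    obtain r where r: "r > 0" "ball x r \<subseteq> U"
      using UK(1,3) open_contains_ball by blast
    then have rK: "ball x r \<subseteq> K"
      using UK(4) by simp
    \<comment> \<open>A ball of radius below \<open>r / 2\<close> whose centre is within that radius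
      of \<open>x\<close> stays in \<open>ball x r\<close>, hence in \<open>K\<close>, and is
      compact as a closed subset.\<close>
    obtain n where n: "1 / real (Suc n) < r / 2"
      using r(1) nat_approx_posE half_gt_zero by blast
    obtain s where s: "s \<in> S" "dist s x < 1 / real (Suc n)"
    proof -
      have "x \<in> closure S" using S(2) by simp
      moreover have "1 / real (Suc n) > 0" by simp
      ultimately show ?thesis
        using that unfolding closure_approachable by blast
    qed
    have "cball s (1 / real (Suc n)) \<subseteq> ball x r"
    proof
      fix y assume "y \<in> cball s (1 / real (Suc n))"
      then have "dist x y < r"
        using n s dist_triangle[of x y s] by (simp add: dist_commute)
      then show "y \<in> ball x r" by simp
    qed
    then have "compact (cball s (1 / real (Suc n)))"
      using compact_Int_closed[OF UK(2) closed_cball[of s "1 / real (Suc n)"]] rK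
      by (metis Int_absorb1 order_trans)
    then have "cball s (1 / real (Suc n)) \<in> P"
      using s(1) by (auto simp: P_def)
    then show ?thesis
      using s(2) by (intro bexI[of _ "cball s (1 / real (Suc n))"]) auto
  qed
  then have "P \<noteq> {}" by blast
  define Q where "Q n = (\<Union>i\<le>n. from_nat_into P i)" for n
  have fP: "from_nat_into P i \<in> P" for i
    by (rule from_nat_into[OF \<open>P \<noteq> {}\<close>])
  show ?thesis
  proof
    show "compact (Q n)" for n
      unfolding Q_def using fP by (intro compact_UN) (auto simp: P_def)
    show "incseq Q"
      by (auto simp: incseq_def Q_def intro: order_trans)
    show "(\<Union>n. Q n) = UNIV"
    proof -
      have "\<exists>n. x \<in> Q n" for x
      proof -
        obtain K where "K \<in> P" "x \<in> K"
          using cover by blast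
        moreover obtain n where "from_nat_into P n = K"
          using from_nat_into_surj[OF \<open>countable P\<close> \<open>K \<in> P\<close>] by blast
        ultimately show ?thesis
          by (auto simp: Q_def)
      qed
      then show ?thesis by blast
    qed
  qed
qed

text \<open>A closed inner approximation is intersected with a compact exhaustion of the space;
  since \<open>M\<close> is finite, the mass lost tends to 0.\<close>

lemma compact_inner_regular:
  fixes M :: "'a::metric_space measure"
  assumes M: "finite_measure M" "sets M = sets borel"
    and lc: "locally_compact_space (euclidean :: 'a topology)"
    and sep: "separable_space (euclidean :: 'a topology)"
    and B: "B \<in> sets borel" and e: "e > 0"
  obtains K where "compact K" "K \<subseteq> B" "measure M (B - K) < e"
proof -
  interpret finite_measure M
    by (rule M)
  obtain C U where C: "closed C" "open U" "C \<subseteq> B" "B \<subseteq> U" "measure M (U - C) < e / 2"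
    using closed_open_regular[OF M B, of "e / 2"] e by auto
  obtain Q :: "nat \<Rightarrow> 'a set" where Q: "\<And>n. compact (Q n)" "incseq Q" "(\<Union>n. Q n) = UNIV"
    using sigma_compact[OF lc sep] by blast
  have "(\<lambda>n. measure M (C \<inter> Q n)) \<longlonglongrightarrow> measure M (\<Union>n. C \<inter> Q n)"
  proof (rule finite_Lim_measure_incseq)
    show "incseq (\<lambda>n. C \<inter> Q n)"
      using Q(2) unfolding incseq_def by blast
  qed (use C Q in \<open>auto simp: M(2) compact_imp_closed\<close>)
  moreover have "(\<Union>n. C \<inter> Q n) = C"
    using Q(3) by auto
  ultimately have "eventually (\<lambda>n. measure M C - e / 2 < measure M (C \<inter> Q n)) sequentially"
    using e by (intro order_tendstoD) auto
  then obtain n where n: "measure M C - e / 2 < measure M (C \<inter> Q n)"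
    by (auto simp: eventually_sequentially)
  have cl: "closed (Q n)"
    using Q(1) by (rule compact_imp_closed)
  have "measure M (B - C \<inter> Q n) \<le> measure M ((U - C) \<union> (C - C \<inter> Q n))"
    by (rule finite_measure_mono) (use C cl in \<open>auto simp: M(2)\<close>)
  also have "\<dots> \<le> measure M (U - C) + measure M (C - C \<inter> Q n)"
    by (rule measure_Un_le) (use C cl in \<open>auto simp: M(2)\<close>)
  also have "measure M (C - C \<inter> Q n) = measure M C - measure M (C \<inter> Q n)"
    by (rule finite_measure_Diff) (use C cl in \<open>auto simp: M(2)\<close>)
  finally have "measure M (B - C \<inter> Q n) < e"
    using C(5) n by simp
  moreover have "compact (C \<inter> Q n)"
    using C(1) Q(1) by (simp add: closed_Int_compact)
  ultimately show ?thesis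
    using that[of "C \<inter> Q n"] C(3) by auto
qed

section \<open>Test functions and separation of disjoint closed sets\<close>

text \<open>A tent of height 1 and width \<open>r\<close> over \<open>K\<close>. Local compactness
  puts an open neighbourhood \<open>W\<close> of \<open>K\<close> inside a compact set, and
  \<open>r\<close> is so small that the tent vanishes off \<open>U \<inter> W\<close>, which makes
  its support compact.\<close>

lemma Cc_bump:
  fixes K :: "'a::metric_space set"
  assumes lc: "locally_compact_space (euclidean :: 'a topology)"
    and K: "compact K" and O: "open U" "K \<subseteq> U"
  obtains \<phi> :: "'a \<Rightarrow> real" where "\<phi> \<in> Cc" "\<And>x. 0 \<le> \<phi> x" "\<And>x. \<phi> x \<le> 1" "\<And>x. x \<in> K \<Longrightarrow> \<phi> x = 1"
    "\<And>x. x \<notin> U \<Longrightarrow> \<phi> x = 0"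
proof (cases "K = {}")
  case True
  \<comment> \<open>For empty \<open>K\<close> the tent formula would give the constant 1, because
    \<open>infdist x {} = 0\<close>.\<close>
  have "(\<lambda>_. 0) \<in> (Cc :: ('a \<Rightarrow> real) set)"
    by (simp add: Cc_def)
  then show ?thesis
    using that[of "\<lambda>_. 0"] True by simp
next
  case False
  have "\<forall>K::'a set. compact K \<longrightarrow> (\<exists>W L. open W \<and> compact L \<and> closed L \<and> K \<subseteq> W \<and> W \<subseteq> L)"
    using lc locally_compact_space_compact_closed_compact[of "euclidean :: 'a topology"] by auto
  then obtain W L where WL: "open W" "compact L" "K \<subseteq> W" "W \<subseteq> L"
    using K by meson
  obtain r where r: "r > 0" "(\<Union>x\<in>K. ball x r) \<subseteq> U \<inter> W"
    using compact_subset_open_imp_ball_epsilon_subset[OF K, of "U \<inter> W"] O WL by blast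
  define \<phi> where "\<phi> x = max 0 (1 - infdist x K / r)" for x
  have out: "\<phi> x = 0" if "x \<notin> U \<inter> W" for x
  proof -
    have "r \<le> dist x a" if "a \<in> K" for a
    proof (rule ccontr)
      assume "\<not> r \<le> dist x a"
      then have "x \<in> (\<Union>x\<in>K. ball x r)"
        using that by (force simp: dist_commute)
      then show False
        using r(2) \<open>x \<notin> U \<inter> W\<close> by blast
    qed
    then have "r \<le> infdist x K"
      using False by (simp add: infdist_notempty cINF_greatest)
    then show ?thesis
      using r(1) by (simp add: \<phi>_def)
  qed
  have "{x. \<phi> x \<noteq> 0} \<subseteq> L"
    using out WL(4) by blast
  then have "closure {x. \<phi> x \<noteq> 0} \<subseteq> L"
    using WL(2) by (simp add: closure_minimal compact_imp_closed)
  then have "compact (closure {x. \<phi> x \<noteq> 0})"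
    using WL(2) compact_Int_closed[of L "closure {x. \<phi> x \<noteq> 0}"] by (simp add: Int_absorb1)
  moreover have "continuous_on UNIV \<phi>"
    unfolding \<phi>_def using r(1) by (intro continuous_intros) auto
  ultimately have "\<phi> \<in> Cc"
    by (simp add: Cc_def)
  then show ?thesis
    by (rule that) (use r(1) infdist_nonneg[of _ K] out in \<open>auto simp: \<phi>_def\<close>)
qed

lemma Cc_measurable: "\<phi> \<in> Cc \<Longrightarrow> \<phi> \<in> borel_measurable borel"
  by (simp add: Cc_def borel_measurable_continuous_onI)

text \<open>Distance functions to the \<open>K i\<close>, except that the empty set gets distance 1 because \<open>infdist x {} = 0\<close>.\<close>
lemma disjoint_closed_distances:
  fixes K :: "'i \<Rightarrow> 'a::metric_space set"
  assumes "\<And>i. i \<in> I \<Longrightarrow> closed (K i)" "disjoint_family_on K I"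
  obtains d :: "'i \<Rightarrow> 'a \<Rightarrow> real" where "\<And>i. continuous_on UNIV (d i)"
    "\<And>i x. x \<in> K i \<Longrightarrow> d i x = 0" "\<And>i j x. i \<in> I \<Longrightarrow> j \<in> I \<Longrightarrow> i \<noteq> j \<Longrightarrow> x \<in> K j \<Longrightarrow> d i x > 0"
proof
  let ?d = "\<lambda>i x. if K i = {} then 1 else infdist x (K i)"
  show "continuous_on UNIV (?d i)" for i
    by (cases "K i = {}") (simp_all add: continuous_on_infdist)
  show "?d i x = 0" if "x \<in> K i" for i x
    using that by auto
  show "?d i x > 0" if "i \<in> I" "j \<in> I" "i \<noteq> j" "x \<in> K j" for i j x
  proof -
    have "x \<notin> K i"
      using that assms(2) by (auto simp: disjoint_family_on_def)
    then show ?thesis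
      using assms(1)[OF that(1)] by (simp add: infdist_pos_not_in_closed)
  qed
qed

section \<open>Lower semicontinuity\<close>

lemma Cc_approx_compact:
  fixes \<mu> :: "'a::metric_space set \<Rightarrow> 'v::euclidean_space"
  assumes lc: "locally_compact_space (euclidean :: 'a topology)"
    and \<mu>: "vector_measure \<mu>" and K: "compact K" and G: "open G" "K \<subseteq> G" and e: "e > 0"
  obtains \<phi> where "\<phi> \<in> Cc" "\<And>x. \<bar>\<phi> x\<bar> \<le> 1" "\<And>x. x \<notin> G \<Longrightarrow> \<phi> x = 0"
    "norm (vm_integral \<mu> \<phi> - \<mu> K) < e"
proof -
  interpret finite_measure "l1_variation \<mu>"
    by (rule finite_measure_l1_variation[OF \<mu>])
  have sK: "K \<in> sets borel"
    using K by (simp add: borel_closed compact_imp_closed)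
  obtain C V where V: "closed C" "open V" "C \<subseteq> K" "K \<subseteq> V" "measure (l1_variation \<mu>) (V - C) < e"
    using closed_open_regular[OF finite_measure_l1_variation[OF \<mu>] sets_l1_variation sK e] by blast
  have "measure (l1_variation \<mu>) (V - K) \<le> measure (l1_variation \<mu>) (V - C)"
    by (rule finite_measure_mono) (use V in auto)
  then have VK: "measure (l1_variation \<mu>) (V - K) < e"
    using V by simp
  \<comment> \<open>\<open>V\<close> confines the difference from the indicator of \<open>K\<close>
    to a set of small mass; \<open>G\<close> prescribes where the function may live, so that several
    of them can be made disjointly supported.\<close>
  obtain \<phi> where \<phi>: "\<phi> \<in> Cc" "\<And>x. 0 \<le> \<phi> x" "\<And>x. \<phi> x \<le> 1" "\<And>x. x \<in> K \<Longrightarrow> \<phi> x = 1"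
    "\<And>x. x \<notin> V \<inter> G \<Longrightarrow> \<phi> x = 0"
    using Cc_bump[OF lc K, of "V \<inter> G"] V G by blast
  have ab: "\<bar>\<phi> x\<bar> \<le> 1" for x
    using \<phi>(2,3)[of x] by simp
  have "norm (vm_integral \<mu> \<phi> - vm_integral \<mu> (indicator K)) \<le> 1 * measure (l1_variation \<mu>) (V - K)"
  proof (rule vm_integral_diff_le[OF \<mu> Cc_measurable[OF \<phi>(1)] ab])
    show "\<bar>\<phi> x - indicator K x\<bar> \<le> 1 * indicator (V - K) x" for x
      using \<phi>(2-5)[of x] by (auto simp: indicator_def)
  qed (use sK V in \<open>auto simp: indicator_def\<close>)
  then have "norm (vm_integral \<mu> \<phi> - \<mu> K) < e"
    using VK by (simp add: vm_integral_indicator[OF \<mu> sK])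
  then show ?thesis
    using that[of \<phi>] \<phi>(1,5) ab by blast
qed

lemma tendsto_seminorm:
  fixes N :: "'v::euclidean_space \<Rightarrow> real"
  assumes "seminorm N" "(f \<longlongrightarrow> l) F"
  shows "((\<lambda>x. N (f x)) \<longlongrightarrow> N l) F"
proof -
  obtain C where C: "C \<ge> 0" "\<And>x. N x \<le> C * norm x"
    using seminorm_le_norm[OF assms(1)] by blast
  have "((\<lambda>x. N (f x) - N l) \<longlongrightarrow> 0) F"
  proof (rule Lim_null_comparison)
    show "\<forall>\<^sub>F x in F. norm (N (f x) - N l) \<le> C * norm (f x - l)"
      using order_trans[OF seminorm_diff[OF assms(1)] C(2)] by simp
    have "((\<lambda>x. C * norm (f x - l)) \<longlongrightarrow> C * norm (l - l)) F"
      by (intro tendsto_intros assms)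
    then show "((\<lambda>x. C * norm (f x - l)) \<longlongrightarrow> 0) F" by simp
  qed
  then show ?thesis
    by (simp add: LIM_zero_iff)
qed

text \<open>Disjointly supported test functions concentrated on compact subsets of a near-optimal partition
  of \<open>U\<close> detect the variation of \<open>\<mu>\<close> on \<open>U\<close>.\<close>
lemma tv_lower_semicontinuous:
  fixes \<mu> :: "'a::metric_space set \<Rightarrow> 'v::euclidean_space"
  assumes lc: "locally_compact_space (euclidean :: 'a topology)"
    and sep: "separable_space (euclidean :: 'a topology)"
    and N: "seminorm N" and \<mu>s: "\<And>n. vector_measure (\<mu>s n)" and \<mu>: "vector_measure \<mu>"
    and wide: "widely_converges \<mu>s \<mu>" and U: "open U" and a: "a < tv N \<mu> U"
  shows "eventually (\<lambda>n. a < tv N (\<mu>s n) U) sequentially"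
proof -
  have sU: "U \<in> sets borel"
    using U by simp
  obtain m :: nat and E where E: "disjoint_family_on E {..<m}" "\<And>i. i < m \<Longrightarrow> E i \<in> sets borel"
    "\<And>i. i < m \<Longrightarrow> E i \<subseteq> U" "a < (\<Sum>i<m. N (\<mu> (E i)))"
    by (rule tv_approx[OF \<mu> N sU a], rule that)
  obtain C where C: "C \<ge> 0" "\<And>x. N x \<le> C * norm x"
    using seminorm_le_norm[OF N] by blast
  define g where "g = (\<Sum>i<m. N (\<mu> (E i))) - a"
  have "0 \<le> real m * C * 2" "g > 0"
    using C E(4) by (auto simp: g_def)
  \<comment> \<open>Each piece loses at most \<delta> in norm when shrunk to \<open>K i\<close> and
    again when \<open>K i\<close> is replaced by its test function; over \<open>m\<close> pieces,
    weighted by \<open>C\<close>, this has to stay below the gap \<open>g\<close>. The summand 1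
    excludes a zero denominator.\<close>
  define \<delta> where "\<delta> = g / (real m * C * 2 + 1)"
  have \<delta>: "\<delta> > 0" "real m * C * 2 * \<delta> < g"
    using \<open>0 \<le> real m * C * 2\<close> \<open>g > 0\<close> by (auto simp: \<delta>_def field_simps)
  have "\<exists>K. compact K \<and> K \<subseteq> E i \<and> measure (l1_variation \<mu>) (E i - K) < \<delta>" if "i < m" for i
    by (rule compact_inner_regular[OF finite_measure_l1_variation[OF \<mu>] sets_l1_variation lc sep
          E(2)[OF that] \<delta>(1)]) blast
  then have "\<forall>i. \<exists>K. i < m \<longrightarrow> compact K \<and> K \<subseteq> E i \<and> measure (l1_variation \<mu>) (E i - K) < \<delta>"
    by blast
  then obtain K where K: "\<And>i. i < m \<Longrightarrow> compact (K i)" "\<And>i. i < m \<Longrightarrow> K i \<subseteq> E i"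
    "\<And>i. i < m \<Longrightarrow> measure (l1_variation \<mu>) (E i - K i) < \<delta>"
    unfolding choice_iff by blast
  have clK: "closed (K i)" if "i \<in> {..<m}" for i
    using K(1)[of i] that by (auto intro: compact_imp_closed)
  have disjK: "disjoint_family_on K {..<m}"
    using E(1) K(2) unfolding disjoint_family_on_def by blast
  obtain d :: "nat \<Rightarrow> 'a \<Rightarrow> real" where d: "\<And>i. continuous_on UNIV (d i)"
    "\<And>i x. x \<in> K i \<Longrightarrow> d i x = 0"
    "\<And>i j x. i \<in> {..<m} \<Longrightarrow> j \<in> {..<m} \<Longrightarrow> i \<noteq> j \<Longrightarrow> x \<in> K j \<Longrightarrow> d i x > 0"
    by (rule disjoint_closed_distances[OF _ disjK], erule clK, rule that)
  \<comment> \<open>Intersecting with \<open>U\<close> keeps the test functions inside the set whose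
    variation is to be bounded.\<close>
  define G where "G i = U \<inter> (\<Inter>j\<in>{..<m} - {i}. {x. d i x < d j x})" for i
  have G: "open (G i)" for i
    unfolding G_def using U d(1) by (intro open_Int open_INT ballI open_Collect_less) auto
  have KG: "K i \<subseteq> G i" if "i < m" for i
  proof
    fix x assume x: "x \<in> K i"
    then have "x \<in> U"
      using E(3)[OF that] K(2)[OF that] by blast
    moreover have "d i x < d j x" if "j \<in> {..<m} - {i}" for j
      using d(2)[OF x] d(3)[of j i x] x that \<open>i < m\<close> by auto
    ultimately show "x \<in> G i"
      unfolding G_def by blast
  qed
  have disjG: "disjoint_family_on G {..<m}"
    unfolding disjoint_family_on_def
  proof (intro ballI impI equals0I)
    fix i j x assume "i \<in> {..<m}" "j \<in> {..<m}" "i \<noteq> j" "x \<in> G i \<inter> G j"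
    then have "d i x < d j x" "d j x < d i x"
      unfolding G_def by blast+
    then show False by simp
  qed
  have "\<exists>\<phi>. \<phi> \<in> Cc \<and> (\<forall>x. \<bar>\<phi> x\<bar> \<le> 1) \<and> (\<forall>x. x \<notin> G i \<longrightarrow> \<phi> x = 0) \<and>
      norm (vm_integral \<mu> \<phi> - \<mu> (K i)) < \<delta>" if "i < m" for i
    by (rule Cc_approx_compact[OF lc \<mu> K(1)[OF that] G KG[OF that] \<delta>(1)]) blast
  then have "\<forall>i. \<exists>\<phi>. i < m \<longrightarrow> \<phi> \<in> Cc \<and> (\<forall>x. \<bar>\<phi> x\<bar> \<le> 1) \<and> (\<forall>x. x \<notin> G i \<longrightarrow> \<phi> x = 0) \<and>
      norm (vm_integral \<mu> \<phi> - \<mu> (K i)) < \<delta>"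
    by blast
  then obtain \<phi> where \<phi>: "\<And>i. i < m \<Longrightarrow> \<phi> i \<in> Cc" "\<And>i x. i < m \<Longrightarrow> \<bar>\<phi> i x\<bar> \<le> 1"
    "\<And>i x. i < m \<Longrightarrow> x \<notin> G i \<Longrightarrow> \<phi> i x = 0"
    "\<And>i. i < m \<Longrightarrow> norm (vm_integral \<mu> (\<phi> i) - \<mu> (K i)) < \<delta>"
    unfolding choice_iff by blast
  have close: "N (\<mu> (E i)) \<le> N (vm_integral \<mu> (\<phi> i)) + C * 2 * \<delta>" if i: "i < m" for i
  proof -
    have sK: "K i \<in> sets borel"
      using K(1)[OF i] by (simp add: compact_imp_closed)
    have "norm (\<mu> (E i) - \<mu> (K i)) \<le> measure (l1_variation \<mu>) (E i - K i)"
      using norm_le_l1_variation[OF \<mu>, of "E i - K i"] vector_measure_Diff[OF \<mu> E(2)[OF i] sK K(2)[OF i]]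
        E(2)[OF i] sK by simp
    then have "norm (\<mu> (E i) - vm_integral \<mu> (\<phi> i)) \<le> 2 * \<delta>"
      using K(3)[OF i] \<phi>(4)[OF i]
        norm_triangle_ineq[of "\<mu> (E i) - \<mu> (K i)" "\<mu> (K i) - vm_integral \<mu> (\<phi> i)"]
      by (simp add: norm_minus_commute)
    then have "C * norm (\<mu> (E i) - vm_integral \<mu> (\<phi> i)) \<le> C * (2 * \<delta>)"
      by (intro mult_left_mono C)
    then show ?thesis
      using seminorm_diff[OF N, of "\<mu> (E i)" "vm_integral \<mu> (\<phi> i)"]
        C(2)[of "\<mu> (E i) - vm_integral \<mu> (\<phi> i)"] by simp
  qed
  have "(\<Sum>i<m. N (\<mu> (E i))) \<le> (\<Sum>i<m. N (vm_integral \<mu> (\<phi> i)) + C * 2 * \<delta>)"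
    by (rule sum_mono) (use close in auto)
  then have "a < (\<Sum>i<m. N (vm_integral \<mu> (\<phi> i)))"
    using \<delta>(2) by (simp add: sum.distrib g_def)
  \<comment> \<open>The test functions depend on \<mu> alone and are finite in number, so wide
    convergence passes to the sum.\<close>
  moreover have "(\<lambda>n. \<Sum>i<m. N (vm_integral (\<mu>s n) (\<phi> i))) \<longlonglongrightarrow> (\<Sum>i<m. N (vm_integral \<mu> (\<phi> i)))"
    by (intro tendsto_sum tendsto_seminorm[OF N]) (use wide \<phi>(1) in \<open>auto simp: widely_converges_def\<close>)
  ultimately have "eventually (\<lambda>n. a < (\<Sum>i<m. N (vm_integral (\<mu>s n) (\<phi> i)))) sequentially"
    by (intro order_tendstoD)
  then show ?thesis
  proof eventually_elim
    case (elim n)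
    have "(\<Sum>i<m. N (vm_integral (\<mu>s n) (\<phi> i))) \<le> (\<Sum>i<m. tv N (\<mu>s n) (G i))"
      by (intro sum_mono seminorm_vm_integral_le_tv[OF \<mu>s N])
        (use G \<phi> in \<open>auto intro: Cc_measurable\<close>)
    also have "\<dots> \<le> tv N (\<mu>s n) (\<Union>i<m. G i)"
      by (rule tv_superadd_UN[OF \<mu>s N]) (use G disjG in auto)
    also have "\<dots> \<le> tv N (\<mu>s n) U"
    proof (rule tv_mono[OF \<mu>s N])
      show "(\<Union>i<m. G i) \<subseteq> U"
        by (auto simp: G_def)
    qed (use G sU in auto)
    finally show ?case
      using elim by simp
  qed
qed

section \<open>Convergence of the ranges and of scalar variations\<close>

lemma vm_range_mem: "E \<in> sets borel \<Longrightarrow> \<mu> E \<in> vm_range \<mu>"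
  unfolding vm_range_def vm_range_on_def
  by (intro subsetD[OF closure_subset] hull_inc) auto

lemma closed_vm_range: "closed (vm_range \<mu>)"
  by (simp add: vm_range_def vm_range_on_def)

lemma bounded_vm_range:
  assumes "vector_measure \<mu>"
  shows "bounded (vm_range \<mu>)"
proof -
  obtain B where "\<And>E. E \<in> sets borel \<Longrightarrow> norm (\<mu> E) \<le> B"
    using vector_measure_bounded[OF assms] by blast
  then have "bounded {\<mu> E | E. E \<in> sets borel \<and> E \<subseteq> UNIV}"
    unfolding bounded_iff by blast
  then show ?thesis
    unfolding vm_range_def vm_range_on_def by (intro bounded_closure bounded_convex_hull)
qed

text \<open>\<open>jordan_pos\<close> of the component along \<open>x\<close> is the support
  function of the range in direction \<open>x\<close>: a half-space is closed and convex, so taking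
  the closed convex hull does not raise the supremum.\<close>

lemma vm_range_inner_le:
  fixes \<mu> :: "'a::topological_space set \<Rightarrow> 'v::euclidean_space"
  assumes "vector_measure \<mu>" "y \<in> vm_range \<mu>"
  shows "y \<bullet> x \<le> jordan_pos (\<lambda>A. \<mu> A \<bullet> x) UNIV"
proof -
  have "vm_range \<mu> \<subseteq> {y. x \<bullet> y \<le> jordan_pos (\<lambda>A. \<mu> A \<bullet> x) UNIV}"
    unfolding vm_range_def vm_range_on_def
    by (intro closure_minimal hull_minimal convex_halfspace_le closed_halfspace_le)
      (auto simp: inner_commute[of x] intro!: jordan_pos_upper[OF vector_measure_inner[OF assms(1)]])
  then show ?thesis
    using assms(2) by (auto simp: inner_commute)
qed

lemma hausdorff_dist_commute: "hausdorff_dist S T = hausdorff_dist T S"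
  unfolding hausdorff_dist_def by (rule max.commute)

text \<open>Boundedness of \<open>S\<close> bounds the distances above, so that the real supremum in
  \<open>hausdorff_dist\<close> is an actual upper bound.\<close>

lemma infdist_le_hausdorff_dist:
  assumes "bounded S" "T \<noteq> {}" "s \<in> S"
  shows "infdist s T \<le> hausdorff_dist S T"
proof -
  obtain t where t: "t \<in> T"
    using assms by blast
  obtain B where B: "\<And>y. y \<in> S \<Longrightarrow> dist t y \<le> B"
    using assms(1) bounded_any_center[of S t] by blast
  have "infdist y T \<le> B" if "y \<in> S" for y
    using infdist_le[OF t, of y] B[OF that] by (simp add: dist_commute)
  then have "bdd_above ((\<lambda>x. infdist x T) ` S)"
    by (intro bdd_aboveI2)
  then have "infdist s T \<le> (SUP x\<in>S. infdist x T)"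
    using assms(3) by (rule cSUP_upper2) simp
  then show ?thesis
    unfolding hausdorff_dist_def by simp
qed

text \<open>Support functions are Lipschitz for the Hausdorff distance: a point of one range has a
  nearest point in the other, and by Cauchy-Schwarz their components along \<open>x\<close> differ
  by at most \<open>norm x\<close> times the distance.\<close>

lemma jordan_pos_inner_le_hausdorff_dist:
  fixes \<mu> \<nu> :: "'a::topological_space set \<Rightarrow> 'v::euclidean_space"
  assumes \<mu>: "vector_measure \<mu>" and \<nu>: "vector_measure \<nu>"
  shows "jordan_pos (\<lambda>A. \<mu> A \<bullet> x) UNIV
    \<le> jordan_pos (\<lambda>A. \<nu> A \<bullet> x) UNIV + norm x * hausdorff_dist (vm_range \<mu>) (vm_range \<nu>)"
proof (rule jordan_pos_least)
  fix E :: "'a set" assume "E \<in> sets borel"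
  then have E: "\<mu> E \<in> vm_range \<mu>"
    by (rule vm_range_mem)
  have ne: "vm_range \<nu> \<noteq> {}"
    using vm_range_mem[of "{}" \<nu>] by blast
  obtain y where y: "y \<in> vm_range \<nu>" "infdist (\<mu> E) (vm_range \<nu>) = dist (\<mu> E) y"
    using infdist_attains_inf[OF closed_vm_range ne] by blast
  have "\<mu> E \<bullet> x = y \<bullet> x + (\<mu> E - y) \<bullet> x"
    by (simp add: inner_diff_left)
  also have "y \<bullet> x \<le> jordan_pos (\<lambda>A. \<nu> A \<bullet> x) UNIV"
    by (rule vm_range_inner_le[OF \<nu> y(1)])
  also have "(\<mu> E - y) \<bullet> x \<le> norm x * dist (\<mu> E) y"
    using norm_cauchy_schwarz[of "\<mu> E - y" x] by (simp add: dist_norm mult.commute)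
  also have "norm x * dist (\<mu> E) y \<le> norm x * hausdorff_dist (vm_range \<mu>) (vm_range \<nu>)"
    using infdist_le_hausdorff_dist[OF bounded_vm_range[OF \<mu>] ne E] y(2)
    by (simp add: mult_left_mono)
  finally show "\<mu> E \<bullet> x \<le> jordan_pos (\<lambda>A. \<nu> A \<bullet> x) UNIV + norm x * hausdorff_dist (vm_range \<mu>) (vm_range \<nu>)"
    by simp
qed

lemma tendsto_jordan_pos_inner:
  fixes \<mu>s :: "nat \<Rightarrow> 'a::topological_space set \<Rightarrow> 'v::euclidean_space" and \<mu> :: "'a set \<Rightarrow> 'v"
  assumes \<mu>s: "\<And>n. vector_measure (\<mu>s n)" and \<mu>: "vector_measure \<mu>"
    and hd: "(\<lambda>n. hausdorff_dist (vm_range (\<mu>s n)) (vm_range \<mu>)) \<longlonglongrightarrow> 0"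
  shows "(\<lambda>n. jordan_pos (\<lambda>A. \<mu>s n A \<bullet> x) UNIV) \<longlonglongrightarrow> jordan_pos (\<lambda>A. \<mu> A \<bullet> x) UNIV"
proof -
  have "(\<lambda>n. jordan_pos (\<lambda>A. \<mu>s n A \<bullet> x) UNIV - jordan_pos (\<lambda>A. \<mu> A \<bullet> x) UNIV) \<longlonglongrightarrow> 0"
  proof (rule Lim_null_comparison)
    show "\<forall>\<^sub>F n in sequentially. norm (jordan_pos (\<lambda>A. \<mu>s n A \<bullet> x) UNIV - jordan_pos (\<lambda>A. \<mu> A \<bullet> x) UNIV)
        \<le> norm x * hausdorff_dist (vm_range (\<mu>s n)) (vm_range \<mu>)"
    proof (intro always_eventually allI)
      fix n
      show "norm (jordan_pos (\<lambda>A. \<mu>s n A \<bullet> x) UNIV - jordan_pos (\<lambda>A. \<mu> A \<bullet> x) UNIV)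
        \<le> norm x * hausdorff_dist (vm_range (\<mu>s n)) (vm_range \<mu>)"
        using jordan_pos_inner_le_hausdorff_dist[OF \<mu>s[of n] \<mu>, of x]
          jordan_pos_inner_le_hausdorff_dist[OF \<mu> \<mu>s[of n], of x]
          hausdorff_dist_commute[of "vm_range (\<mu>s n)" "vm_range \<mu>"]
        by (simp add: abs_le_iff)
    qed
    show "(\<lambda>n. norm x * hausdorff_dist (vm_range (\<mu>s n)) (vm_range \<mu>)) \<longlonglongrightarrow> 0"
      using tendsto_mult_left[OF hd, of "norm x"] by simp
  qed
  then show ?thesis
    by (simp add: LIM_zero_iff)
qed

text \<open>One inequality groups the pieces of a family by the sign of their component along
  \<open>x\<close>; the other tests the variation on two-piece partitions \<open>E\<close>,
  \<open>UNIV - E\<close>.\<close>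

lemma tv_inner_UNIV:
  fixes \<mu> :: "'a::topological_space set \<Rightarrow> 'v::euclidean_space"
  assumes \<mu>: "vector_measure \<mu>"
  shows "tv (\<lambda>w. \<bar>w \<bullet> x\<bar>) \<mu> UNIV =
    jordan_pos (\<lambda>A. \<mu> A \<bullet> x) UNIV + jordan_pos (\<lambda>A. \<mu> A \<bullet> (- x)) UNIV"
proof (rule antisym)
  note v = vector_measure_inner[OF \<mu>]
  let ?c = "\<lambda>A. \<mu> A \<bullet> x"
  show "tv (\<lambda>w. \<bar>w \<bullet> x\<bar>) \<mu> UNIV \<le> jordan_pos ?c UNIV + jordan_pos (\<lambda>A. \<mu> A \<bullet> (- x)) UNIV"
  proof (rule tv_least[OF \<mu> seminorm_inner])
    fix m :: nat and E :: "nat \<Rightarrow> 'a set"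
    assume E: "disjoint_family_on E {..<m}" "\<And>i. i < m \<Longrightarrow> E i \<in> sets borel"
    define P where "P = {i. i < m \<and> ?c (E i) \<ge> 0}"
    define Q where "Q = {i. i < m \<and> ?c (E i) < 0}"
    have PQ: "{..<m} = P \<union> Q" "P \<inter> Q = {}" "finite P" "finite Q"
      by (auto simp: P_def Q_def)
    have "(\<Sum>i<m. \<bar>?c (E i)\<bar>) = (\<Sum>i\<in>P. \<bar>?c (E i)\<bar>) + (\<Sum>i\<in>Q. \<bar>?c (E i)\<bar>)"
      unfolding PQ(1) by (rule sum.union_disjoint) (use PQ in auto)
    also have "(\<Sum>i\<in>P. \<bar>?c (E i)\<bar>) = (\<Sum>i\<in>P. ?c (E i))"
      by (rule sum.cong) (auto simp: P_def)
    also have "\<dots> = ?c (\<Union>i\<in>P. E i)"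
      by (rule vector_measure_UN[OF v, symmetric])
        (use E PQ in \<open>auto simp: P_def disjoint_family_on_def\<close>)
    also have "\<dots> \<le> jordan_pos ?c UNIV"
      by (rule jordan_pos_upper[OF v]) (use E PQ in \<open>auto simp: P_def\<close>)
    also have "(\<Sum>i\<in>Q. \<bar>?c (E i)\<bar>) = (\<Sum>i\<in>Q. \<mu> (E i) \<bullet> (- x))"
      by (rule sum.cong) (auto simp: Q_def)
    also have "\<dots> = \<mu> (\<Union>i\<in>Q. E i) \<bullet> (- x)"
      by (rule vector_measure_UN[OF v, symmetric])
        (use E PQ in \<open>auto simp: Q_def disjoint_family_on_def\<close>)
    also have "\<dots> \<le> jordan_pos (\<lambda>A. \<mu> A \<bullet> (- x)) UNIV"
      by (rule jordan_pos_upper[OF v]) (use E PQ in \<open>auto simp: Q_def\<close>)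
    finally show "(\<Sum>i<m. \<bar>?c (E i)\<bar>) \<le> jordan_pos ?c UNIV + jordan_pos (\<lambda>A. \<mu> A \<bullet> (- x)) UNIV"
      by simp
  qed simp
  have le: "\<bar>?c E\<bar> + \<bar>?c (UNIV - E)\<bar> \<le> tv (\<lambda>w. \<bar>w \<bullet> x\<bar>) \<mu> UNIV" if "E \<in> sets borel" for E
    using seminorm_le_tv[OF \<mu> seminorm_inner[of x], of E] seminorm_le_tv[OF \<mu> seminorm_inner[of x], of "UNIV - E"]
      tv_superadd[OF \<mu> seminorm_inner[of x], of E "UNIV - E"] that by simp
  have D: "?c (UNIV - E) = ?c UNIV - ?c E" if "E \<in> sets borel" for E
    using vector_measure_Diff[OF v] that by simp
  \<comment> \<open>Twice \<open>?c E\<close> equals \<open>?c E - ?c (UNIV - E) + ?c UNIV\<close>,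
    hence is at most the variation plus \<open>?c UNIV\<close>. The latter term cancels against the
    analogous bound for \<open>- x\<close>.\<close>
  have "jordan_pos ?c UNIV \<le> (tv (\<lambda>w. \<bar>w \<bullet> x\<bar>) \<mu> UNIV + ?c UNIV) / 2"
  proof (rule jordan_pos_least)
    fix E :: "'a set" assume "E \<in> sets borel"
    then show "?c E \<le> (tv (\<lambda>w. \<bar>w \<bullet> x\<bar>) \<mu> UNIV + ?c UNIV) / 2"
      using le[of E] D[of E] by simp
  qed
  moreover have "jordan_pos (\<lambda>A. \<mu> A \<bullet> (- x)) UNIV \<le> (tv (\<lambda>w. \<bar>w \<bullet> x\<bar>) \<mu> UNIV - ?c UNIV) / 2"
  proof (rule jordan_pos_least)
    fix E :: "'a set" assume "E \<in> sets borel"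
    then show "\<mu> E \<bullet> (- x) \<le> (tv (\<lambda>w. \<bar>w \<bullet> x\<bar>) \<mu> UNIV - ?c UNIV) / 2"
      using le[of E] D[of E] by simp
  qed
  ultimately show "jordan_pos ?c UNIV + jordan_pos (\<lambda>A. \<mu> A \<bullet> (- x)) UNIV \<le> tv (\<lambda>w. \<bar>w \<bullet> x\<bar>) \<mu> UNIV"
    by simp
qed

text \<open>No mass is lost in the limit, so lower semicontinuity on the open complement turns into
  upper semicontinuity on closed sets.\<close>
lemma tv_inner_upper_semicontinuous:
  fixes \<mu> :: "'a::metric_space set \<Rightarrow> 'v::euclidean_space"
  assumes lc: "locally_compact_space (euclidean :: 'a topology)"
    and sep: "separable_space (euclidean :: 'a topology)"
    and \<mu>s: "\<And>n. vector_measure (\<mu>s n)" and \<mu>: "vector_measure \<mu>"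
    and wide: "widely_converges \<mu>s \<mu>"
    and hd: "(\<lambda>n. hausdorff_dist (vm_range (\<mu>s n)) (vm_range \<mu>)) \<longlonglongrightarrow> 0"
    and F: "closed F" and a: "tv (\<lambda>w. \<bar>w \<bullet> x\<bar>) \<mu> F < a"
  shows "eventually (\<lambda>n. tv (\<lambda>w. \<bar>w \<bullet> x\<bar>) (\<mu>s n) F < a) sequentially"
proof -
  let ?N = "\<lambda>w. \<bar>w \<bullet> x\<bar>"
  note N = seminorm_inner[of x]
  \<comment> \<open>One half of the slack absorbs the excess of the total variation on the whole
    space, the other the deficit on the open complement.\<close>
  define e where "e = (a - tv ?N \<mu> F) / 2"
  have e: "e > 0"
    using a by (simp add: e_def)
  have "(\<lambda>n. tv ?N (\<mu>s n) UNIV) \<longlonglongrightarrow> tv ?N \<mu> UNIV"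
    unfolding tv_inner_UNIV[OF \<mu>s] tv_inner_UNIV[OF \<mu>]
    by (intro tendsto_add tendsto_jordan_pos_inner \<mu>s \<mu> hd)
  then have "eventually (\<lambda>n. tv ?N (\<mu>s n) UNIV < tv ?N \<mu> UNIV + e) sequentially"
    using e by (intro order_tendstoD) auto
  moreover have "eventually (\<lambda>n. tv ?N \<mu> (- F) - e < tv ?N (\<mu>s n) (- F)) sequentially"
    using F e by (intro tv_lower_semicontinuous[OF lc sep N \<mu>s \<mu> wide]) auto
  ultimately show ?thesis
  proof eventually_elim
    case (elim n)
    have "tv ?N (\<mu>s n) F + tv ?N (\<mu>s n) (- F) \<le> tv ?N (\<mu>s n) UNIV"
      using tv_superadd[OF \<mu>s N, of F "- F"] F by (simp add: Compl_partition)
    moreover have "tv ?N \<mu> UNIV \<le> tv ?N \<mu> F + tv ?N \<mu> (- F)"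
      using tv_subadd[OF \<mu> N, of F "- F"] F by (simp add: Compl_partition)
    ultimately show ?case
      using elim unfolding e_def by argo
  qed
qed

section \<open>The upper bound\<close>

text \<open>Bessel's inequality for the orthonormal pair \<open>v\<close>, \<open>e\<close> bounds
  the square of \<open>w \<bullet> e\<close> by
  \<open>2 * norm w * (norm w - w \<bullet> v)\<close>. The arithmetic-geometric mean inequality,
  weighted by \<open>t\<close>, replaces the square root by a bound that is linear in
  \<open>norm w\<close> and in the deficit, and can therefore be summed over pieces.\<close>

lemma abs_inner_le_deficit:
  fixes v e w :: "'v::real_inner"
  assumes "norm v = 1" "norm e = 1" "v \<bullet> e = 0" and t: "t > 0"
  shows "\<bar>w \<bullet> e\<bar> \<le> t * norm w + (norm w - w \<bullet> v) / (2 * t)"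
proof -
  define n p where "n = norm w" and "p = w \<bullet> v"
  have p: "\<bar>p\<bar> \<le> n"
    using Cauchy_Schwarz_ineq2[of w v] assms by (simp add: n_def p_def)
  have "v \<bullet> v = 1" "e \<bullet> e = 1" "e \<bullet> v = 0"
    using assms by (simp_all add: norm_eq_1 inner_commute)
  then have "(w - p *\<^sub>R v - (w \<bullet> e) *\<^sub>R e) \<bullet> (w - p *\<^sub>R v - (w \<bullet> e) *\<^sub>R e) = w \<bullet> w - p\<^sup>2 - (w \<bullet> e)\<^sup>2"
    using assms(3) by (simp add: p_def inner_diff_left inner_diff_right inner_commute power2_eq_square algebra_simps)
  then have "(w \<bullet> e)\<^sup>2 \<le> n\<^sup>2 - p\<^sup>2"
    using inner_ge_zero[of "w - p *\<^sub>R v - (w \<bullet> e) *\<^sub>R e"] by (simp add: n_def power2_norm_eq_inner)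
  also have "n\<^sup>2 - p\<^sup>2 = (n - p) * (n + p)"
    by (simp add: power2_eq_square algebra_simps)
  also have "\<dots> \<le> (n - p) * (2 * n)"
    using p by (intro mult_left_mono) auto
  also have "\<dots> = 4 * (t * n) * ((n - p) / (2 * t))"
    using t by (simp add: field_simps)
  also have "\<dots> \<le> (t * n + (n - p) / (2 * t))\<^sup>2"
  proof -
    have "4 * x * y \<le> (x + y)\<^sup>2" for x y :: real
      using zero_le_power2[of "x - y"] by (simp add: power2_eq_square algebra_simps)
    then show ?thesis .
  qed
  finally have "\<bar>w \<bullet> e\<bar> \<le> \<bar>t * n + (n - p) / (2 * t)\<bar>"
    by (simp only: abs_le_square_iff)
  moreover have "t * n + (n - p) / (2 * t) \<ge> 0"
    using t p by (intro add_nonneg_nonneg) (auto simp: n_def)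
  ultimately show ?thesis
    by (simp add: n_def p_def)
qed

text \<open>If \<open>\<mu> E\<close> almost exhausts the variation of \<open>\<mu>\<close> on \<open>E\<close> and points in direction \<open>v\<close>, then \<open>\<mu>\<close>
  varies little on \<open>E\<close> in the directions orthogonal to \<open>v\<close>.\<close>
lemma tv_orthogonal_le:
  fixes \<mu> :: "'a::topological_space set \<Rightarrow> 'v::euclidean_space"
  assumes \<mu>: "vector_measure \<mu>" and E: "E \<in> sets borel"
    and v: "norm v = 1" "norm e = 1" "v \<bullet> e = 0" and t: "t > 0"
  shows "tv (\<lambda>w. \<bar>w \<bullet> e\<bar>) \<mu> E \<le> t * tv norm \<mu> E + (tv norm \<mu> E - \<mu> E \<bullet> v) / (2 * t)"
proof (rule tv_least[OF \<mu> seminorm_inner E])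
  fix m :: nat and A
  assume A: "disjoint_family_on A {..<m}" "\<And>i. i < m \<Longrightarrow> A i \<in> sets borel" "\<And>i. i < m \<Longrightarrow> A i \<subseteq> E"
  \<comment> \<open>The remainder of \<open>E\<close> is appended as piece \<open>m\<close>: only
    for a full partition do the values add up to \<open>\<mu> E\<close>, so that the deficits can be
    summed exactly. The appended deficit is nonnegative and may be dropped afterwards.\<close>
  define A' where "A' i = (if i < m then A i else E - (\<Union>j<m. A j))" for i
  have sU: "(\<Union>j<m. A j) \<in> sets borel"
    using A(2) by auto
  have A': "A' i \<in> sets borel" "A' i \<subseteq> E" for i
    using A E sU by (auto simp: A'_def)
  have dA': "disjoint_family_on A' {..<Suc m}"
    using A(1) unfolding disjoint_family_on_def A'_def by auto
  have "(\<Union>i<Suc m. A' i) = E"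
    using A(3) by (auto simp: A'_def lessThan_Suc split: if_splits)
  then have sum: "(\<Sum>i<Suc m. \<mu> (A' i)) = \<mu> E"
    using vector_measure_UN[OF \<mu>, of "{..<Suc m}" A'] A' dA' by simp
  have tvA: "(\<Sum>i<k. norm (\<mu> (A' i))) \<le> tv norm \<mu> E" if "k \<le> Suc m" for k
    by (rule tv_upper[OF \<mu> seminorm_norm E])
      (use A' that in \<open>auto intro: disjoint_family_on_mono[OF _ dA']\<close>)
  have pos: "0 \<le> norm w - w \<bullet> v" for w
    using norm_cauchy_schwarz[of w v] v by simp
  have "(\<Sum>i<m. norm (\<mu> (A' i)) - \<mu> (A' i) \<bullet> v) \<le> (\<Sum>i<Suc m. norm (\<mu> (A' i)) - \<mu> (A' i) \<bullet> v)"
    using pos by simp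
  also have "\<dots> = (\<Sum>i<Suc m. norm (\<mu> (A' i))) - \<mu> E \<bullet> v"
    unfolding sum_subtractf by (simp only: inner_sum_left[symmetric] sum)
  also have "\<dots> \<le> tv norm \<mu> E - \<mu> E \<bullet> v"
    using tvA[of "Suc m"] by simp
  finally have 1: "(\<Sum>i<m. norm (\<mu> (A' i)) - \<mu> (A' i) \<bullet> v) \<le> tv norm \<mu> E - \<mu> E \<bullet> v" .
  have "(\<Sum>i<m. \<bar>\<mu> (A i) \<bullet> e\<bar>) = (\<Sum>i<m. \<bar>\<mu> (A' i) \<bullet> e\<bar>)"
    by (rule sum.cong) (auto simp: A'_def)
  also have "\<dots> \<le> (\<Sum>i<m. t * norm (\<mu> (A' i)) + (norm (\<mu> (A' i)) - \<mu> (A' i) \<bullet> v) / (2 * t))"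
    by (intro sum_mono abs_inner_le_deficit v t)
  also have "\<dots> = t * (\<Sum>i<m. norm (\<mu> (A' i))) + (\<Sum>i<m. norm (\<mu> (A' i)) - \<mu> (A' i) \<bullet> v) / (2 * t)"
    by (simp only: sum.distrib sum_distrib_left sum_divide_distrib)
  also have "\<dots> \<le> t * tv norm \<mu> E + (tv norm \<mu> E - \<mu> E \<bullet> v) / (2 * t)"
    using t 1 tvA[of m] by (intro add_mono mult_left_mono divide_right_mono) auto
  finally show "(\<Sum>i<m. \<bar>\<mu> (A i) \<bullet> e\<bar>) \<le> t * tv norm \<mu> E + (tv norm \<mu> E - \<mu> E \<bullet> v) / (2 * t)" .
qed

text \<open>The residual is orthogonal to \<open>S\<close>, hence to the whole space, hence to
  itself.\<close>

lemma orthonormal_expansion: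
  fixes S :: "'v::euclidean_space set"
  assumes S: "pairwise orthogonal S" "\<And>x. x \<in> S \<Longrightarrow> norm x = 1" "span S = UNIV" "finite S"
  shows "w = (\<Sum>e\<in>S. (w \<bullet> e) *\<^sub>R e)"
proof -
  define z where "z = w - (\<Sum>e\<in>S. (w \<bullet> e) *\<^sub>R e)"
  have "orthogonal z f" if f: "f \<in> S" for f
  proof -
    have "(\<Sum>e\<in>S. (w \<bullet> e) * (e \<bullet> f)) = (\<Sum>e\<in>S. if e = f then w \<bullet> f else 0)"
    proof (rule sum.cong)
      fix e assume "e \<in> S"
      then show "(w \<bullet> e) * (e \<bullet> f) = (if e = f then w \<bullet> f else 0)"
        using S(1,2) f by (auto simp: pairwise_def orthogonal_def norm_eq_1)
    qed simp
    also have "\<dots> = w \<bullet> f"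
      using f S(4) by simp
    finally show ?thesis
      by (simp add: z_def orthogonal_def inner_diff_left inner_sum_left)
  qed
  then have "orthogonal z z"
    using S(3) by (intro orthogonal_to_span[of z S z]) auto
  then show ?thesis
    by (simp add: z_def orthogonal_def)
qed

text \<open>Only the direction \<open>v\<close> keeps its exact weight \<open>N v\<close>; the crude
  weight \<open>C\<close> suffices for the others, along which the variation will be small.\<close>

lemma tv_le_directional:
  fixes \<mu> :: "'a::topological_space set \<Rightarrow> 'v::euclidean_space"
  assumes \<mu>: "vector_measure \<mu>" and N: "seminorm N" and C: "\<And>x. N x \<le> C * norm x"
    and F: "F \<in> sets borel"
    and S: "pairwise orthogonal S" "\<And>x. x \<in> S \<Longrightarrow> norm x = 1" "span S = UNIV" "finite S"
    and v: "v \<in> S"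
  shows "tv N \<mu> F \<le> N v * tv (\<lambda>w. \<bar>w \<bullet> v\<bar>) \<mu> F + (\<Sum>e\<in>S - {v}. C * tv (\<lambda>w. \<bar>w \<bullet> e\<bar>) \<mu> F)"
proof (rule tv_least[OF \<mu> N F])
  fix m :: nat and E
  assume E: "disjoint_family_on E {..<m}" "\<And>i. i < m \<Longrightarrow> E i \<in> sets borel" "\<And>i. i < m \<Longrightarrow> E i \<subseteq> F"
  have Ce: "N e \<le> C" if "e \<in> S" for e
    using C[of e] S(2)[OF that] by simp
  have C0: "C \<ge> 0"
    using Ce[OF v] seminorm_nonneg[OF N, of v] by simp
  have Nle: "N w \<le> N v * \<bar>w \<bullet> v\<bar> + (\<Sum>e\<in>S - {v}. C * \<bar>w \<bullet> e\<bar>)" for w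
  proof -
    have "N w = N (\<Sum>e\<in>S. (w \<bullet> e) *\<^sub>R e)"
      using orthonormal_expansion[OF S, of w] by simp
    also have "\<dots> \<le> (\<Sum>e\<in>S. N ((w \<bullet> e) *\<^sub>R e))"
      by (rule seminorm_sum[OF N])
    also have "\<dots> = N ((w \<bullet> v) *\<^sub>R v) + (\<Sum>e\<in>S - {v}. N ((w \<bullet> e) *\<^sub>R e))"
      by (rule sum.remove[OF S(4) v])
    also have "\<dots> \<le> N v * \<bar>w \<bullet> v\<bar> + (\<Sum>e\<in>S - {v}. C * \<bar>w \<bullet> e\<bar>)"
      using Ce by (intro add_mono sum_mono) (auto simp: seminorm_scaleR[OF N] mult.commute mult_right_mono)
    finally show ?thesis .
  qed
  have up: "(\<Sum>i<m. \<bar>\<mu> (E i) \<bullet> e\<bar>) \<le> tv (\<lambda>w. \<bar>w \<bullet> e\<bar>) \<mu> F" for e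
    by (rule tv_upper[OF \<mu> seminorm_inner F]) (use E in auto)
  have "(\<Sum>i<m. N (\<mu> (E i))) \<le> (\<Sum>i<m. N v * \<bar>\<mu> (E i) \<bullet> v\<bar> + (\<Sum>e\<in>S - {v}. C * \<bar>\<mu> (E i) \<bullet> e\<bar>))"
    by (intro sum_mono Nle)
  also have "\<dots> = N v * (\<Sum>i<m. \<bar>\<mu> (E i) \<bullet> v\<bar>) + (\<Sum>e\<in>S - {v}. C * (\<Sum>i<m. \<bar>\<mu> (E i) \<bullet> e\<bar>))"
    unfolding sum.distrib sum_distrib_left by (subst (2) sum.swap) simp
  also have "\<dots> \<le> N v * tv (\<lambda>w. \<bar>w \<bullet> v\<bar>) \<mu> F + (\<Sum>e\<in>S - {v}. C * tv (\<lambda>w. \<bar>w \<bullet> e\<bar>) \<mu> F)"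
    by (intro add_mono sum_mono mult_left_mono up C0 seminorm_nonneg N)
  finally show "(\<Sum>i<m. N (\<mu> (E i)))
      \<le> N v * tv (\<lambda>w. \<bar>w \<bullet> v\<bar>) \<mu> F + (\<Sum>e\<in>S - {v}. C * tv (\<lambda>w. \<bar>w \<bullet> e\<bar>) \<mu> F)" .
qed

section \<open>Partition, closed cells and the final estimate\<close>

text \<open>Appending the uncovered remainder turns a nearly optimal family into a partition without
  lowering the sum. It also makes \<open>m\<close> positive, as required for taking a minimum over
  the pieces later.\<close>

lemma near_optimal_partition:
  fixes \<mu> :: "'a::topological_space set \<Rightarrow> 'v::euclidean_space"
  assumes \<mu>: "vector_measure \<mu>" and N: "seminorm N" and \<eta>: "\<eta> > 0"
  obtains m :: nat and E where "m > 0" "disjoint_family_on E {..<m}" "\<And>i. i < m \<Longrightarrow> E i \<in> sets borel"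
    "(\<Union>i<m. E i) = UNIV" "tv N \<mu> UNIV - \<eta> < (\<Sum>i<m. N (\<mu> (E i)))"
proof -
  obtain m :: nat and A where A: "disjoint_family_on A {..<m}" "\<And>i. i < m \<Longrightarrow> A i \<in> sets borel"
    "\<And>i. i < m \<Longrightarrow> A i \<subseteq> UNIV" "tv N \<mu> UNIV - \<eta> < (\<Sum>i<m. N (\<mu> (A i)))"
    by (rule tv_approx[OF \<mu> N, of UNIV "tv N \<mu> UNIV - \<eta>"]) (use \<eta> in auto)
  define E where "E i = (if i < m then A i else - (\<Union>j<m. A j))" for i
  have "(\<Sum>i<m. N (\<mu> (E i))) = (\<Sum>i<m. N (\<mu> (A i)))"
    by (rule sum.cong) (auto simp: E_def)
  then have "tv N \<mu> UNIV - \<eta> < (\<Sum>i<Suc m. N (\<mu> (E i)))"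
    using A(4) seminorm_nonneg[OF N, of "\<mu> (E m)"] by simp
  moreover have "disjoint_family_on E {..<Suc m}"
    using A(1) unfolding disjoint_family_on_def E_def by auto
  moreover have "E i \<in> sets borel" for i
  proof -
    have "- (\<Union>j<m. A j) \<in> sets borel"
      by (intro borel_comp sets.finite_UN) (use A(2) in auto)
    then show ?thesis
      using A(2) unfolding E_def by presburger
  qed
  moreover have "(\<Union>i<Suc m. E i) = UNIV"
    by (auto simp: E_def lessThan_Suc split: if_splits)
  ultimately show ?thesis
    using that[of "Suc m" E] by simp
qed

text \<open>The zero vector gets an arbitrary unit direction, so pieces with value 0 are treated
  like all others.\<close>

lemma unit_direction:
  fixes x :: "'v::euclidean_space"
  obtains v where "norm v = 1" "x = norm x *\<^sub>R v"
proof (cases "x = 0")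
  case True
  obtain b :: 'v where "b \<in> Basis"
    using nonempty_Basis by blast
  then show ?thesis
    using that[of b] True by simp
next
  case False
  then show ?thesis
    using that[of "x /\<^sub>R norm x"] by simp
qed

lemma obtain_small_mult:
  fixes r :: real
  assumes "r > 0"
  obtains x where "x > 0" "B * x < r"
proof
  show "r / (\<bar>B\<bar> + 1) > 0"
    using assms by (simp add: add_nonneg_pos)
  have "B * (r / (\<bar>B\<bar> + 1)) \<le> \<bar>B\<bar> * (r / (\<bar>B\<bar> + 1))"
    using assms by (intro mult_right_mono) auto
  also have "\<dots> < r"
    using assms by (simp add: field_simps)
  finally show "B * (r / (\<bar>B\<bar> + 1)) < r" .
qed

lemma eventually_tv_UNIV_less:
  fixes \<mu>s :: "nat \<Rightarrow> 'a::metric_space set \<Rightarrow> 'v::euclidean_space" and \<mu> :: "'a set \<Rightarrow> 'v"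
  assumes lc: "locally_compact_space (euclidean :: 'a topology)"
    and sep: "separable_space (euclidean :: 'a topology)"
    and N: "seminorm N" and \<mu>s: "\<And>n. vector_measure (\<mu>s n)" and \<mu>: "vector_measure \<mu>"
    and wide: "widely_converges \<mu>s \<mu>"
    and hd: "(\<lambda>n. hausdorff_dist (vm_range (\<mu>s n)) (vm_range \<mu>)) \<longlonglongrightarrow> 0"
    and r: "r > 0"
  shows "eventually (\<lambda>n. tv N (\<mu>s n) UNIV < tv N \<mu> UNIV + r) sequentially"
proof -
  obtain C where C: "C \<ge> 0" "\<And>x. N x \<le> C * norm x"
    using seminorm_le_norm[OF N] by blast
  define T where "T = tv norm \<mu> UNIV"
  \<comment> \<open>The total weight of all basis directions when each counts
    \<open>C\<close>.\<close>
  define A where "A = C * real DIM('v)"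
  have A: "A \<ge> 0" "C \<le> A"
    using C(1) mult_left_mono[of 1 "real DIM('v)" C] by (auto simp: A_def DIM_positive Suc_leI)
  \<comment> \<open>Three errors get \<open>r / 3\<close> each: the linearisation
    (\<open>t\<close>), the deficit of the partition (\<eta>, which appears divided by
    \<open>t\<close>), and the passage from pieces to cells (\<delta>, which appears multiplied by
    powers of \<open>m\<close>). This dictates the order of the choices.\<close>
  obtain t where t: "t > 0" "(A * T) * t < r / 3"
    using obtain_small_mult[of "r / 3"] r by auto
  obtain \<eta> where \<eta>: "\<eta> > 0" "(A + A / (2 * t)) * \<eta> < r / 3"
    using obtain_small_mult[of "r / 3"] r by auto
  obtain m :: nat and E where E: "m > 0" "disjoint_family_on E {..<m}" "\<And>i. i < m \<Longrightarrow> E i \<in> sets borel"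
    "(\<Union>i<m. E i) = UNIV" "tv norm \<mu> UNIV - \<eta> < (\<Sum>i<m. norm (\<mu> (E i)))"
    by (rule near_optimal_partition[OF \<mu> seminorm_norm \<eta>(1)], rule that)
  obtain \<delta> where \<delta>: "\<delta> > 0" "(A * real m * (real m + 1)) * \<delta> < r / 3"
    using obtain_small_mult[of "r / 3"] r by auto
  \<comment> \<open>The Euclidean deficit of a single piece; by superadditivity of the variation the
    deficits add up to at most \<eta>.\<close>
  define \<eta>' where "\<eta>' i = tv norm \<mu> (E i) - norm (\<mu> (E i))" for i
  have \<eta>'0: "\<eta>' i \<ge> 0" if "i < m" for i
    using seminorm_le_tv[OF \<mu> seminorm_norm E(3)[OF that]] by (simp add: \<eta>'_def)
  have sumT: "(\<Sum>i<m. tv norm \<mu> (E i)) \<le> T"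
    using tv_superadd_UN[OF \<mu> seminorm_norm, of "{..<m}" E] E by (simp add: T_def)
  then have sum\<eta>: "(\<Sum>i<m. \<eta>' i) \<le> \<eta>"
    using E(5) by (simp add: \<eta>'_def sum_subtractf T_def)
  \<comment> \<open>Each piece gets its own orthonormal basis through its direction. The cardinality
    is recorded because the number of transverse directions enters the error.\<close>
  have "\<forall>i. \<exists>v S. norm v = 1 \<and> \<mu> (E i) = norm (\<mu> (E i)) *\<^sub>R v \<and> v \<in> S \<and> pairwise orthogonal S \<and>
      (\<forall>x\<in>S. norm x = 1) \<and> card S = DIM('v) \<and> span S = UNIV \<and> finite S"
  proof
    fix i
    obtain v where v: "norm v = 1" "\<mu> (E i) = norm (\<mu> (E i)) *\<^sub>R v"
      by (rule unit_direction)
    obtain S where "v \<in> S" "pairwise orthogonal S" "\<And>x. x \<in> S \<Longrightarrow> norm x = 1"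
      "independent S" "card S = DIM('v)" "span S = UNIV"
      by (rule vector_in_orthonormal_basis[OF v(1)], rule that)
    then show "\<exists>v S. norm v = 1 \<and> \<mu> (E i) = norm (\<mu> (E i)) *\<^sub>R v \<and> v \<in> S \<and> pairwise orthogonal S \<and>
      (\<forall>x\<in>S. norm x = 1) \<and> card S = DIM('v) \<and> span S = UNIV \<and> finite S"
      using v by (intro exI[of _ v] exI[of _ S]) (auto intro: finiteI_independent)
  qed
  then obtain v S where v: "\<And>i. norm (v i) = 1" "\<And>i. \<mu> (E i) = norm (\<mu> (E i)) *\<^sub>R v i" "\<And>i. v i \<in> S i"
    and S: "\<And>i. pairwise orthogonal (S i)" "\<And>i x. x \<in> S i \<Longrightarrow> norm x = 1" "\<And>i. card (S i) = DIM('v)"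
    "\<And>i. span (S i) = UNIV" "\<And>i. finite (S i)"
    unfolding choice_iff by blast
  have "\<exists>K. compact K \<and> K \<subseteq> E i \<and> measure (l1_variation \<mu>) (E i - K) < \<delta>" if "i < m" for i
    by (rule compact_inner_regular[OF finite_measure_l1_variation[OF \<mu>] sets_l1_variation lc sep
          E(3)[OF that] \<delta>(1)]) blast
  then have "\<forall>i. \<exists>K. i < m \<longrightarrow> compact K \<and> K \<subseteq> E i \<and> measure (l1_variation \<mu>) (E i - K) < \<delta>"
    by blast
  then obtain K where K: "\<And>i. i < m \<Longrightarrow> compact (K i)" "\<And>i. i < m \<Longrightarrow> K i \<subseteq> E i"
    "\<And>i. i < m \<Longrightarrow> measure (l1_variation \<mu>) (E i - K i) < \<delta>"
    unfolding choice_iff by blast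
  have clK: "closed (K i)" if "i \<in> {..<m}" for i
    using K(1)[of i] that by (auto intro: compact_imp_closed)
  have disjK: "disjoint_family_on K {..<m}"
    using E(2) K(2) unfolding disjoint_family_on_def by blast
  obtain d :: "nat \<Rightarrow> 'a \<Rightarrow> real" where d: "\<And>i. continuous_on UNIV (d i)"
    "\<And>i x. x \<in> K i \<Longrightarrow> d i x = 0"
    "\<And>i j x. i \<in> {..<m} \<Longrightarrow> j \<in> {..<m} \<Longrightarrow> i \<noteq> j \<Longrightarrow> x \<in> K j \<Longrightarrow> d i x > 0"
    by (rule disjoint_closed_distances[OF _ disjK], erule clK, rule that)
  define F where "F i = (\<Inter>j\<in>{..<m}. {x. d i x \<le> d j x})" for i
  have F: "closed (F i)" for i
    unfolding F_def by (intro closed_INT ballI closed_Collect_le d(1))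
  have cover: "(\<Union>i<m. F i) = UNIV"
  proof -
    have "\<exists>i<m. x \<in> F i" for x
    proof -
      have "finite ((\<lambda>i. d i x) ` {..<m})" "(\<lambda>i. d i x) ` {..<m} \<noteq> {}"
        using E(1) by auto
      then have "Min ((\<lambda>i. d i x) ` {..<m}) \<in> (\<lambda>i. d i x) ` {..<m}"
        by (rule Min_in)
      then obtain i where i: "i < m" "d i x = Min ((\<lambda>i. d i x) ` {..<m})"
        by auto
      then have "x \<in> F i"
        unfolding F_def by auto
      then show ?thesis
        using i by blast
    qed
    then show ?thesis by blast
  qed
  \<comment> \<open>Off \<open>E i\<close>, a cell meets only the remainders
    \<open>E j - K j\<close>: on \<open>K j\<close> the function \<open>d j\<close> vanishes while
    \<open>d i\<close> is positive, which contradicts minimality of \<open>d i\<close>.\<close>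
  have F_sub: "F i \<subseteq> E i \<union> (\<Union>j<m. E j - K j)" if i: "i < m" for i
  proof
    fix x assume x: "x \<in> F i"
    obtain j where j: "j < m" "x \<in> E j"
      using E(4) by blast
    show "x \<in> E i \<union> (\<Union>j<m. E j - K j)"
    proof (cases "j = i")
      case False
      have "x \<notin> K j"
      proof
        assume "x \<in> K j"
        then have "d j x = 0" "d i x > 0"
          using d(2,3) i j(1) False by auto
        moreover have "d i x \<le> d j x"
          using x j(1) by (auto simp: F_def)
        ultimately show False by simp
      qed
      then show ?thesis
        using j by blast
    qed (use j in auto)
  qed
  have tvF: "tv (\<lambda>w. \<bar>w \<bullet> e\<bar>) \<mu> (F i) \<le> tv (\<lambda>w. \<bar>w \<bullet> e\<bar>) \<mu> (E i) + real m * \<delta>"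
    if i: "i < m" and e: "norm e = 1" for i e
  proof -
    let ?tv = "tv (\<lambda>w. \<bar>w \<bullet> e\<bar>) \<mu>"
    have sEK: "E j - K j \<in> sets borel" if "j < m" for j
      using E(3)[OF that] clK[of j] that by auto
    have sU: "(\<Union>j<m. E j - K j) \<in> sets borel"
      using sEK by auto
    have "?tv (F i) \<le> ?tv (E i \<union> (\<Union>j<m. E j - K j))"
      by (rule tv_mono[OF \<mu> seminorm_inner]) (use F sU E(3) F_sub i in auto)
    also have "\<dots> \<le> ?tv (E i) + ?tv (\<Union>j<m. E j - K j)"
      by (rule tv_subadd[OF \<mu> seminorm_inner E(3)[OF i] sU])
    also have "?tv (\<Union>j<m. E j - K j) \<le> (\<Sum>j<m. ?tv (E j - K j))"
      by (rule tv_subadd_UN[OF \<mu> seminorm_inner]) (use sEK in auto)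
    also have "\<dots> \<le> (\<Sum>j<m. \<delta>)"
    proof (rule sum_mono)
      fix j assume "j \<in> {..<m}"
      then have j: "j < m" by simp
      have "?tv (E j - K j) \<le> 1 * measure (l1_variation \<mu>) (E j - K j)"
        using Cauchy_Schwarz_ineq2[of _ e] e
        by (intro tv_le_l1_variation[OF \<mu> seminorm_inner sEK[OF j]]) auto
      then show "?tv (E j - K j) \<le> \<delta>"
        using K(3)[OF j] by simp
    qed
    finally show ?thesis by simp
  qed
  \<comment> \<open>Of the \<open>m + 1\<close> multiples of \<delta>, \<open>m\<close> pay for the
    remainders inside the cell and one creates the strict inequality that upper semicontinuity
    requires. Finitely many pairs of a cell and a direction are involved, so one threshold for
    \<open>n\<close> serves all.\<close>
  have "eventually (\<lambda>n. \<forall>i\<in>{..<m}. \<forall>e\<in>S i. tv (\<lambda>w. \<bar>w \<bullet> e\<bar>) (\<mu>s n) (F i)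
      < tv (\<lambda>w. \<bar>w \<bullet> e\<bar>) \<mu> (E i) + (real m + 1) * \<delta>) sequentially"
  proof (intro eventually_ball_finite ballI finite_lessThan S(5))
    fix i e assume i: "i \<in> {..<m}" and e: "e \<in> S i"
    have "tv (\<lambda>w. \<bar>w \<bullet> e\<bar>) \<mu> (F i) < tv (\<lambda>w. \<bar>w \<bullet> e\<bar>) \<mu> (E i) + (real m + 1) * \<delta>"
      using tvF[of i e] i S(2)[OF e] \<delta>(1) by (simp add: distrib_right)
    then show "\<forall>\<^sub>F n in sequentially. tv (\<lambda>w. \<bar>w \<bullet> e\<bar>) (\<mu>s n) (F i)
        < tv (\<lambda>w. \<bar>w \<bullet> e\<bar>) \<mu> (E i) + (real m + 1) * \<delta>"
      by (rule tv_inner_upper_semicontinuous[OF lc sep \<mu>s \<mu> wide hd F])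
  qed
  then show ?thesis
  proof eventually_elim
    case (elim n)
    let ?tv = "\<lambda>e. tv (\<lambda>w. \<bar>w \<bullet> e\<bar>) (\<mu>s n)"
    define q where "q = (real m + 1) * \<delta>"
    have q: "q \<ge> 0"
      using \<delta>(1) by (simp add: q_def)
    \<comment> \<open>Summed over \<open>i\<close>, the three error terms become the quantities made
      smaller than \<open>r / 3\<close> above.\<close>
    have piece: "tv N (\<mu>s n) (F i) \<le> N (\<mu> (E i)) + ((A + A / (2 * t)) * \<eta>' i + (A * t) * tv norm \<mu> (E i) + A * q)"
      if i: "i < m" for i
    proof -
      define Ti where "Ti = tv norm \<mu> (E i)"
      have Ti: "Ti \<ge> 0"
        unfolding Ti_def by (rule tv_nonneg[OF \<mu> seminorm_norm E(3)[OF i]])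
      have small: "?tv e (F i) \<le> t * Ti + \<eta>' i / (2 * t) + q" if e: "e \<in> S i - {v i}" for e
      proof -
        have "\<mu> (E i) \<bullet> v i = norm (\<mu> (E i))"
          using v(1)[of i] by (subst v(2)) (simp add: norm_eq_1)
        moreover have "v i \<bullet> e = 0"
          using S(1)[of i] v(3)[of i] e by (auto simp: pairwise_def orthogonal_def)
        ultimately have "tv (\<lambda>w. \<bar>w \<bullet> e\<bar>) \<mu> (E i) \<le> t * Ti + \<eta>' i / (2 * t)"
          using tv_orthogonal_le[OF \<mu> E(3)[OF i] v(1)[of i] _ _ t(1), of e] S(2)[of e i] e
          by (simp add: Ti_def \<eta>'_def)
        moreover have "?tv e (F i) < tv (\<lambda>w. \<bar>w \<bullet> e\<bar>) \<mu> (E i) + q"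
          using elim i e by (simp add: q_def)
        ultimately show ?thesis by simp
      qed
      have main: "?tv (v i) (F i) \<le> norm (\<mu> (E i)) + \<eta>' i + q"
      proof -
        have "tv (\<lambda>w. \<bar>w \<bullet> v i\<bar>) \<mu> (E i) \<le> Ti"
          unfolding Ti_def
        proof (rule tv_least[OF \<mu> seminorm_inner E(3)[OF i]])
          fix k :: nat and B
          assume B: "disjoint_family_on B {..<k}" "\<And>j. j < k \<Longrightarrow> B j \<in> sets borel" "\<And>j. j < k \<Longrightarrow> B j \<subseteq> E i"
          have "(\<Sum>j<k. \<bar>\<mu> (B j) \<bullet> v i\<bar>) \<le> (\<Sum>j<k. norm (\<mu> (B j)))"
            using Cauchy_Schwarz_ineq2[of _ "v i"] v(1)[of i] by (intro sum_mono) simp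
          also have "\<dots> \<le> tv norm \<mu> (E i)"
            by (rule tv_upper[OF \<mu> seminorm_norm E(3)[OF i]]) (use B in auto)
          finally show "(\<Sum>j<k. \<bar>\<mu> (B j) \<bullet> v i\<bar>) \<le> tv norm \<mu> (E i)" .
        qed
        moreover have "?tv (v i) (F i) < tv (\<lambda>w. \<bar>w \<bullet> v i\<bar>) \<mu> (E i) + q"
          using elim i v(3)[of i] by (simp add: q_def)
        ultimately show ?thesis
          by (simp add: Ti_def \<eta>'_def)
      qed
      have "N (\<mu> (E i)) = N (norm (\<mu> (E i)) *\<^sub>R v i)"
        using v(2)[of i] by simp
      then have Nv: "N (v i) * norm (\<mu> (E i)) = N (\<mu> (E i))" "N (v i) \<le> C" "0 \<le> N (v i)"
        using C(2)[of "v i"] v(1)[of i] seminorm_nonneg[OF N] by (simp_all add: seminorm_scaleR[OF N])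
      have D: "card (S i - {v i}) = DIM('v) - 1"
        using S(3,5)[of i] v(3)[of i] by simp
      \<comment> \<open>Of the total weight \<open>A\<close>, the direction \<open>v i\<close> takes
        \<open>C\<close> and the transverse directions share the rest.\<close>
      have D': "real (DIM('v) - 1) * C = A - C"
        using DIM_positive[where 'a='v] by (simp add: A_def of_nat_diff Suc_leI algebra_simps)
      have "tv N (\<mu>s n) (F i) \<le> N (v i) * ?tv (v i) (F i) + (\<Sum>e\<in>S i - {v i}. C * ?tv e (F i))"
        by (rule tv_le_directional[OF \<mu>s N C(2) _ S(1,2,4,5) v(3)]) (use F in auto)
      also have "\<dots> \<le> N (v i) * (norm (\<mu> (E i)) + \<eta>' i + q)
          + (\<Sum>e\<in>S i - {v i}. C * (t * Ti + \<eta>' i / (2 * t) + q))"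
        by (intro add_mono sum_mono mult_left_mono main small C(1) Nv(3))
      also have "\<dots> = N (\<mu> (E i)) + N (v i) * (\<eta>' i + q) + (A - C) * (t * Ti + \<eta>' i / (2 * t) + q)"
        by (simp add: D D'[symmetric] Nv(1)[symmetric] algebra_simps)
      also have "\<dots> \<le> N (\<mu> (E i)) + C * (\<eta>' i + q) + (A - C) * (t * Ti + \<eta>' i / (2 * t) + q)"
        using Nv(2) \<eta>'0[OF i] q by (simp add: mult_right_mono)
      also have "\<dots> = N (\<mu> (E i)) + (C * \<eta>' i + (A - C) * (t * Ti + \<eta>' i / (2 * t)) + A * q)"
        by (simp add: algebra_simps)
      also have "\<dots> \<le> N (\<mu> (E i)) + (A * \<eta>' i + A * (t * Ti + \<eta>' i / (2 * t)) + A * q)"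
        using A(2) C(1) \<eta>'0[OF i] Ti t(1) by (intro add_left_mono add_right_mono add_mono mult_right_mono) auto
      also have "\<dots> = N (\<mu> (E i)) + ((A + A / (2 * t)) * \<eta>' i + (A * t) * Ti + A * q)"
        by (simp add: algebra_simps)
      finally show ?thesis
        by (simp add: Ti_def)
    qed
    have "tv N (\<mu>s n) UNIV \<le> (\<Sum>i<m. tv N (\<mu>s n) (F i))"
      using tv_subadd_UN[OF \<mu>s N, of "{..<m}" F n] F by (simp add: cover)
    also have "\<dots> \<le> (\<Sum>i<m. N (\<mu> (E i)) + ((A + A / (2 * t)) * \<eta>' i + (A * t) * tv norm \<mu> (E i) + A * q))"
      by (intro sum_mono piece) simp
    also have "\<dots> = (\<Sum>i<m. N (\<mu> (E i))) + ((A + A / (2 * t)) * (\<Sum>i<m. \<eta>' i)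
        + (A * t) * (\<Sum>i<m. tv norm \<mu> (E i)) + real m * (A * q))"
      by (simp add: sum.distrib sum_distrib_left)
    also have "\<dots> \<le> tv N \<mu> UNIV + ((A + A / (2 * t)) * \<eta> + (A * t) * T + real m * (A * q))"
    proof (intro add_mono mult_left_mono order_refl sum\<eta> sumT)
      show "(\<Sum>i<m. N (\<mu> (E i))) \<le> tv N \<mu> UNIV"
        by (rule tv_upper[OF \<mu> N]) (use E in auto)
    qed (use A t in auto)
    also have "(A + A / (2 * t)) * \<eta> + (A * t) * T + real m * (A * q) < r"
    proof -
      have "(A * t) * T < r / 3" "real m * (A * q) < r / 3"
        using t(2) \<delta>(2) by (simp_all only: q_def mult_ac)
      then show ?thesis
        using \<eta>(2) by linarith
    qed
    finally show ?case by simp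
  qed
qed

theorem theorem1:
  fixes \<mu>s :: "nat \<Rightarrow> 'a::metric_space set \<Rightarrow> 'v::euclidean_space"
    and \<mu> :: "'a set \<Rightarrow> 'v"
    and N :: "'v \<Rightarrow> real"
  assumes "locally_compact_space (euclidean :: 'a topology)"
    and "separable_space (euclidean :: 'a topology)"
    and "seminorm N"
    and "\<And>n. vector_measure (\<mu>s n)"
    and "vector_measure \<mu>"
    and "widely_converges \<mu>s \<mu>"
    and "(\<lambda>n. hausdorff_dist (vm_range (\<mu>s n)) (vm_range \<mu>)) \<longlonglongrightarrow> 0"
  shows "(\<lambda>n. total_variation N (\<mu>s n) UNIV) \<longlonglongrightarrow> total_variation N \<mu> UNIV"
proof -
  have "(\<lambda>n. tv N (\<mu>s n) UNIV) \<longlonglongrightarrow> tv N \<mu> UNIV"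
  proof (rule order_tendstoI)
    fix a assume "a < tv N \<mu> UNIV"
    then show "eventually (\<lambda>n. a < tv N (\<mu>s n) UNIV) sequentially"
      by (intro tv_lower_semicontinuous[OF assms(1-6)]) auto
  next
    fix a assume "tv N \<mu> UNIV < a"
    then show "eventually (\<lambda>n. tv N (\<mu>s n) UNIV < a) sequentially"
      using eventually_tv_UNIV_less[OF assms, of "a - tv N \<mu> UNIV"] by simp
  qed
  then show ?thesis
    by (simp add: total_variation_eq_tv assms)
qed

end
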